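(* There exists a topologically convex polyhedron, all of whose faces are acute isosceles triangles, that has no one-piece edge unfolding.
   Context: A polyhedron is a compact subset of $\mathbb{R}^3$ whose boundary surface is a closed embedded surface made of finitely many planar polygonal faces meeting edge-to-edge. It is topologically convex if its surface is homeomorphic to a sphere and its graph of vertices and edges is a 3-vertex-connected planar graph, i.e. it is combinatorially equivalent to a convex polyhedron. An edge unfolding is specified by a set of edges (the cut edges). Cutting the surface along them separates it into connected pieces. The unfolding is valid if each piece can be laid out isometrically in the plane, face by face, as a simple (non-self-overlapping) polygon. A one-piece edge unfolding is a valid edge unfolding with exactly one piece. *)

theory Defs
  imports "HOL-Analysis.Analysis"
begin

text \<open>A polyhedron all of whose faces are triangles is encoded by a map pos from
vertex labels (natural numbers) to points of R^3 and a set F of faces, each face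
being a 3-element set of vertex labels.  The geometric face is the convex hull of
its three vertex positions.\<close>

definition tri :: "(nat \<Rightarrow> real^3) \<Rightarrow> nat set \<Rightarrow> (real^3) set" where
  "tri pos f = convex hull (pos ` f)"

definition surface :: "(nat \<Rightarrow> real^3) \<Rightarrow> nat set set \<Rightarrow> (real^3) set" where
  "surface pos F = (\<Union>f\<in>F. tri pos f)"

definition edges :: "nat set set \<Rightarrow> nat set set" where
  "edges F = {e. card e = 2 \<and> (\<exists>f\<in>F. e \<subseteq> f)}"

definition graph_connected :: "nat set \<Rightarrow> nat set set \<Rightarrow> bool" where
  "graph_connected W E \<longleftrightarrow>
     (\<forall>u\<in>W. \<forall>v\<in>W. (\<lambda>x y. {x, y} \<in> E \<and> x \<in> W \<and> y \<in> W)\<^sup>*\<^sup>* u v)"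

definition three_connected :: "nat set \<Rightarrow> nat set set \<Rightarrow> bool" where
  "three_connected V E \<longleftrightarrow> finite V \<and> card V \<ge> 4 \<and>
     (\<forall>S. S \<subseteq> V \<and> card S \<le> 2 \<longrightarrow> graph_connected (V - S) E)"

text \<open>Topologically convex polyhedron whose faces are exactly the triangles in F:
nondegenerate triangles forming an embedded simplicial surface (two triangles meet
exactly in the hull of their common vertices, i.e. edge-to-edge), every edge in
exactly two faces, adjacent triangles not coplanar (so each triangle is a genuine
planar face), the surface is homeomorphic to the sphere and bounds a compact set,
and the vertex-edge graph is 3-connected (planarity is automatic since the graph is
drawn on a surface homeomorphic to the sphere).\<close>
definition topologically_convex_triangle_polyhedron ::
  "(nat \<Rightarrow> real^3) \<Rightarrow> nat set set \<Rightarrow> bool" where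
  "topologically_convex_triangle_polyhedron pos F \<longleftrightarrow>
     finite F \<and> F \<noteq> {} \<and>
     (\<forall>f\<in>F. card f = 3 \<and> \<not> collinear (pos ` f)) \<and>
     inj_on pos (\<Union>F) \<and>
     (\<forall>f\<in>F. \<forall>g\<in>F. tri pos f \<inter> tri pos g = tri pos (f \<inter> g)) \<and>
     (\<forall>e\<in>edges F. card {f\<in>F. e \<subseteq> f} = 2) \<and>
     (\<forall>f\<in>F. \<forall>g\<in>F. f \<noteq> g \<and> card (f \<inter> g) = 2 \<longrightarrow> \<not> coplanar (pos ` (f \<union> g))) \<and>
     surface pos F homeomorphic sphere (0::real^3) 1 \<and>
     (\<exists>P::(real^3) set. compact P \<and> frontier P = surface pos F) \<and>
     three_connected (\<Union>F) (edges F)"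

definition acute_isosceles :: "real^3 \<Rightarrow> real^3 \<Rightarrow> real^3 \<Rightarrow> bool" where
  "acute_isosceles A B C \<longleftrightarrow> \<not> collinear {A, B, C} \<and>
     (B - A) \<bullet> (C - A) > 0 \<and> (A - B) \<bullet> (C - B) > 0 \<and> (A - C) \<bullet> (B - C) > 0 \<and>
     (dist A B = dist A C \<or> dist B A = dist B C \<or> dist C A = dist C B)"

definition acute_isosceles_face :: "(nat \<Rightarrow> real^3) \<Rightarrow> nat set \<Rightarrow> bool" where
  "acute_isosceles_face pos f \<longleftrightarrow>
     (\<exists>a b c. f = {a, b, c} \<and> acute_isosceles (pos a) (pos b) (pos c))"

definition uncut_adj :: "nat set set \<Rightarrow> nat set set \<Rightarrow> nat set \<Rightarrow> nat set \<Rightarrow> bool" where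
  "uncut_adj F C f g \<longleftrightarrow> f \<in> F \<and> g \<in> F \<and> f \<noteq> g \<and> card (f \<inter> g) = 2 \<and> f \<inter> g \<notin> C"

text \<open>In the cut surface, the copy of point x in face f and its copy in face g are
identified iff f and g are linked by a chain of faces glued along uncut edges that
contain x.\<close>
definition glued_at :: "(nat \<Rightarrow> real^3) \<Rightarrow> nat set set \<Rightarrow> nat set set \<Rightarrow> real^3
    \<Rightarrow> nat set \<Rightarrow> nat set \<Rightarrow> bool" where
  "glued_at pos F C x f g \<longleftrightarrow> uncut_adj F C f g \<and> x \<in> tri pos (f \<inter> g)"

text \<open>C is a one-piece edge unfolding: C is a set of edges, cutting along C leaves a
single piece (faces connected through uncut edges), and there is a layout A placing
each face isometrically in the plane, consistent along uncut edges, injective on the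
cut surface (no overlap, no boundary self-contact), with image homeomorphic to a
closed disk (a simple polygon).\<close>
definition one_piece_edge_unfolding ::
  "(nat \<Rightarrow> real^3) \<Rightarrow> nat set set \<Rightarrow> nat set set \<Rightarrow> bool" where
  "one_piece_edge_unfolding pos F C \<longleftrightarrow>
     C \<subseteq> edges F \<and>
     (\<forall>f\<in>F. \<forall>g\<in>F. (uncut_adj F C)\<^sup>*\<^sup>* f g) \<and>
     (\<exists>A :: nat set \<Rightarrow> real^3 \<Rightarrow> real^2.
        (\<forall>f\<in>F. \<forall>x\<in>tri pos f. \<forall>y\<in>tri pos f. dist (A f x) (A f y) = dist x y) \<and>
        (\<forall>f\<in>F. \<forall>g\<in>F. uncut_adj F C f g \<longrightarrow> (\<forall>x\<in>tri pos (f \<inter> g). A f x = A g x)) \<and>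
        (\<forall>f\<in>F. \<forall>g\<in>F. \<forall>x\<in>tri pos f. \<forall>y\<in>tri pos g.
            A f x = A g y \<longrightarrow> x = y \<and> (glued_at pos F C x)\<^sup>*\<^sup>* f g) \<and>
        (\<Union>f\<in>F. A f ` tri pos f) homeomorphic cball (0::real^2) 1)"

end

theory Submission
  imports Defs
begin

text \<open>Following Bern, Demaine, Eppstein, Kuo, Mantler and Snoeyink, a hat is glued on each face of a
  regular tetrahedron: a brim of six triangles around a small triangle that carries a long spike.  With
  squared edge lengths 32 (tetrahedron), 17 (brim), 2 (spike base) and 97 (spike) all faces are acute
  isosceles, the tip of a spike has positive curvature and the three inner vertices of a hat have
  negative curvature.  Hence an unfolding cuts at least one edge at each tip and at least two at each
  inner vertex.  If only four interior edges of a hat are cut, connectedness of the piece forces the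
  cuts to form a path from a corner through all three inner vertices to the tip; then the spike face
  next to the last cut runs across the brim in the layout.  So each of the four hats
  contains at least five cut edges, 20 in total.  But there are 54 edges, and gluing 36 faces into one
  piece leaves at least 35 of them uncut, hence at most 19 cut.

  The polyhedron is star-shaped around the origin: the cones over its faces subdivide space, which
  gives embeddedness and, by radial projection, the homeomorphism to the sphere.\<close>

subsection \<open>Overlaps of planar fans\<close>

text \<open>Consecutive spokes at an inner vertex always have inner product 1. In a face with a side
  of squared length 2 the other two sides are equal, so the inner product at an end of that side is
  2 / 2; in a brim face with squared sides 17, 17, 32 it is (17 + 17 - 32) / 2 at the inner vertex.
  Hence, up to a positive factor, each spoke of a layout arises from the previous one by
  multiplication with 1 + i s or its conjugate, where s = sqrt (n * n' - 1) and n, n' are the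
  squared lengths. Whether a fan exceeds a full turn, and where a spike edge ends up, are then read
  off from short products of such numbers and rational bounds for three square roots; angles and
  curvature need not be defined.

  The degree bounds at the tip and at the inner vertices, together with connectedness, still admit
  four cuts in a hat, 16 for the whole polyhedron, which is below 19. The fifth cut comes only from
  the crossing of the spike with the brim, and it has to be forced for each order in which the path
  of cuts can visit the inner vertices.\<close>

lemma complex_step:
  fixes e e' :: complex
  assumes "(cmod e)\<^sup>2 = n" "n > 0" "Re (cnj e * e') = 1"
  shows "e' = e * Complex 1 (Im (cnj e * e')) / of_real n"
proof -
  have 1: "cnj e * e' = Complex 1 (Im (cnj e * e'))"
    using assms(3) by (simp add: complex_eq_iff)
  have 2: "e * cnj e = of_real n"
    using assms(1) by (metis complex_norm_square)
  have "e * (cnj e * e') = of_real n * e'"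
    using 2 by (metis mult.assoc)
  then have "e' * of_real n = e * Complex 1 (Im (cnj e * e'))"
    using 1 by (metis mult.commute)
  then show ?thesis
    using assms(2) by (simp add: eq_divide_eq)
qed

text \<open>Lagrange's identity: the real part of \<open>cnj e * e'\<close> is the dot product and
  the imaginary part the cross product.\<close>

lemma Im_cnj_mult_sq:
  fixes e e' :: complex
  shows "(Im (cnj e * e'))\<^sup>2 = (cmod e)\<^sup>2 * (cmod e')\<^sup>2 - (Re (cnj e * e'))\<^sup>2"
  unfolding cmod_power2 by (simp add: power2_eq_square algebra_simps)

text \<open>\<open>Q\<close> gives the direction of \<open>e4\<close> relative to \<open>e0\<close>.
  The two signs place the positive real axis strictly between \<open>Q\<close> and
  \<open>Q * Complex 1 s\<close>, so \<open>e0\<close> points strictly between \<open>e4\<close> and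
  \<open>e5\<close>. The weights are those of Cramer's rule: they cancel the imaginary parts and
  leave the positive number \<open>s * (cmod Q)\<^sup>2\<close>.\<close>

lemma sector_combination:
  fixes e0 e4 e5 Q :: complex
  assumes e4: "e4 = e0 * Q / of_real N" and e5: "e5 = e4 * Complex 1 s / of_real n"
    and "N > 0" "n > 0" "s > 0" and Q: "Im Q < 0" "Im (Q * Complex 1 s) > 0"
  shows "\<exists>m>0. \<exists>k>0. e0 = of_real m * e4 + of_real k * e5"
proof -
  define c P R where "c = N / (s * (cmod Q)\<^sup>2)" and P: "P = Im (Q * Complex 1 s)" and R: "R = Im Q"
  have Q0: "Q \<noteq> 0" using Q by auto
  have c: "c > 0" and cN: "c / N * (s * (cmod Q)\<^sup>2) = 1"
    using assms Q0 by (simp_all add: c_def)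
  have id: "of_real P * Q - of_real R * (Q * Complex 1 s) = of_real (s * (cmod Q)\<^sup>2)"
    unfolding cmod_power2 P R by (simp add: complex_eq_iff algebra_simps power2_eq_square)
  have "of_real (P * c) * e4 + of_real (- R * n * c) * e5
      = e0 * of_real (c / N) * (of_real P * Q - of_real R * (Q * Complex 1 s))"
    using assms(3,4) unfolding e5 e4 by (simp add: field_simps)
  also have "\<dots> = e0 * of_real (c / N * (s * (cmod Q)\<^sup>2))"
    unfolding id by simp
  finally have "e0 = of_real (P * c) * e4 + of_real (- R * n * c) * e5"
    unfolding cN by simp
  moreover have "P * c > 0" "- R * n * c > 0"
    using c Q assms(4) unfolding P R by (auto simp: mult_less_0_iff)
  ultimately show ?thesis by blast
qed

text \<open>Mirroring the layout conjugates all vectors, so one orientation suffices.\<close>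

lemma fan_overlap:
  fixes e :: "nat \<Rightarrow> complex"
  assumes n: "\<And>i. i \<le> 5 \<Longrightarrow> (cmod (e i))\<^sup>2 = n i" "\<And>i. n i > 0"
    and one: "\<And>i. i < 5 \<Longrightarrow> Re (cnj (e i) * e (Suc i)) = 1"
    and turn: "\<And>i. i < 4 \<Longrightarrow>
      Im (cnj (e i) * e (Suc i)) * Im (cnj (e (Suc i)) * e (Suc (Suc i))) > 0"
    and s: "\<And>i. s i = sqrt (n i * n (Suc i) - 1)"
    and Q: "Im (Complex 1 (s 0) * Complex 1 (s 1) * Complex 1 (s 2) * Complex 1 (s 3)) < 0"
      "Im (Complex 1 (s 0) * Complex 1 (s 1) * Complex 1 (s 2) * Complex 1 (s 3)
        * Complex 1 (s 4)) > 0"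
  shows "\<exists>m>0. \<exists>k>0. e 0 = of_real m * e 4 + of_real k * e 5"
proof -
  have pos: "\<exists>m>0. \<exists>k>0. e 0 = of_real m * e 4 + of_real k * e 5"
    if n: "\<And>i. i \<le> 5 \<Longrightarrow> (cmod (e i))\<^sup>2 = n i"
    and one: "\<And>i. i < 5 \<Longrightarrow> Re (cnj (e i) * e (Suc i)) = 1"
    and pos: "\<And>i. i < 5 \<Longrightarrow> Im (cnj (e i) * e (Suc i)) > 0" for e
  proof -
    have im: "Im (cnj (e i) * e (Suc i)) = s i" if "i < 5" for i
    proof -
      have "(Im (cnj (e i) * e (Suc i)))\<^sup>2 = n i * n (Suc i) - 1"
        unfolding Im_cnj_mult_sq using n[of i] n[of "Suc i"] one[OF that] that by simp
      then show ?thesis using pos[OF that] unfolding s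
        by (metis less_imp_le real_sqrt_unique)
    qed
    have step: "e (Suc i) = e i * Complex 1 (s i) / of_real (n i)" if "i < 5" for i
      using complex_step[OF n[of i] _ one[OF that]] im[OF that] assms(2) that by simp
    have e4: "e 4 = e 0 * (Complex 1 (s 0) * Complex 1 (s 1) * Complex 1 (s 2) * Complex 1 (s 3))
        / of_real (n 0 * n 1 * n 2 * n 3)"
      using step[of 0] step[of 1] step[of 2] step[of 3]
      by (simp add: eval_nat_numeral ac_simps)
    have e5: "e 5 = e 4 * Complex 1 (s 4) / of_real (n 4)"
      using step[of 4] by (simp add: eval_nat_numeral)
    have s4: "s 4 > 0" using im[of 4] pos[of 4] by simp
    show ?thesis
      by (rule sector_combination[OF e4 e5 _ _ s4 Q]) (use assms(2) in auto)
  qed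
  \<comment> \<open>\<open>turn\<close> makes neighbouring sectors agree in orientation, hence all
    five.\<close>
  have "(\<forall>i<5. Im (cnj (e i) * e (Suc i)) > 0) \<or> (\<forall>i<5. Im (cnj (e i) * e (Suc i)) < 0)"
    using turn[of 0] turn[of 1] turn[of 2] turn[of 3]
    by (auto simp: eval_nat_numeral less_Suc_eq zero_less_mult_iff)
  then show ?thesis
  proof
    assume "\<forall>i<5. Im (cnj (e i) * e (Suc i)) > 0"
    then show ?thesis using pos[OF n(1) one] by blast
  next
    assume 2: "\<forall>i<5. Im (cnj (e i) * e (Suc i)) < 0"
    have "\<exists>m>0. \<exists>k>0. cnj (e 0) = of_real m * cnj (e 4) + of_real k * cnj (e 5)"
    proof (rule pos)
      show "(cmod (cnj (e i)))\<^sup>2 = n i" if "i \<le> 5" for i using n(1)[OF that] by simp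
      show "Re (cnj (cnj (e i)) * cnj (e (Suc i))) = 1" if "i < 5" for i
        using one[OF that] by simp
      show "Im (cnj (cnj (e i)) * cnj (e (Suc i))) > 0" if "i < 5" for i
        using 2 that by (auto simp: algebra_simps)
    qed
    then obtain m k where mk: "m > 0" "k > 0"
      "cnj (e 0) = of_real m * cnj (e 4) + of_real k * cnj (e 5)" by blast
    then have "e 0 = of_real m * e 4 + of_real k * e 5"
      by (metis complex_cnj_add complex_cnj_cnj complex_cnj_complex_of_real complex_cnj_mult)
    then show ?thesis using mk by blast
  qed
qed

text \<open>The radicands are 2 * 97 - 1, 2 * 17 - 1 and 17 * 17 - 1; the roots are the tangents of
  the three angles that occur at an inner vertex.\<close>

lemma sqrt_bounds:
  "13.89 < sqrt 193" "sqrt 193 < 13.9" "5.74 < sqrt 33" "sqrt 33 < 5.75"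
  "16.97 < sqrt 288" "sqrt 288 < 16.98"
  by (rule real_less_rsqrt real_less_lsqrt; simp add: power2_eq_square)+

text \<open>The argument of a product is the total angle of its sectors. All five make about 419
  degrees, so the sign is that of a positive angle after one full turn; without any one of them,
  between 332 and 339 degrees remain, where the sine is negative.\<close>

lemma fan_products:
  defines "A \<equiv> Complex 1 (sqrt 193)" and "B \<equiv> Complex 1 (sqrt 33)" and "D \<equiv> Complex 1 (sqrt 288)"
  shows "Im (A * A * B * B * D) > 0" "Im (A * B * B * D) < 0" "Im (A * A * B * D) < 0"
    "Im (A * A * B * B) < 0"
proof -
  define a b c where abc: "a = sqrt 193" "b = sqrt 33" "c = sqrt 288"
  note bd = sqrt_bounds[folded abc]
  have AA: "A * A = Complex (-192) (2 * a)" and BB: "B * B = Complex (-32) (2 * b)"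
    unfolding A_def B_def abc by (simp_all add: complex_eq_iff)
  have BBD: "B * B * D = Complex (-32 - 2 * (b * c)) (2 * b - 32 * c)"
    unfolding BB D_def abc by (simp add: complex_eq_iff)
  have bc: "b * c < 6 * 17" by (rule mult_strict_mono; use bd in auto)
  have abc': "a * (b * c) < 14 * (6 * 17)"
    by (rule mult_strict_mono; use bd bc in auto)
  have "b * c > 1 * 1" by (rule mult_strict_mono; use bd in auto)
  then have ac: "a * (b * c) > 13 * 1" by (intro mult_strict_mono) (use bd in auto)
  have 1: "A * A * B * B * D = Complex (-192) (2 * a) * Complex (-32 - 2 * (b * c)) (2 * b - 32 * c)"
    unfolding AA[symmetric] BBD[symmetric] by (simp add: ac_simps)
  show "Im (A * A * B * B * D) > 0"
    unfolding 1 using bd abc' by (simp add: algebra_simps)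
  have 2: "A * B * B * D = Complex 1 a * Complex (-32 - 2 * (b * c)) (2 * b - 32 * c)"
    unfolding BBD[symmetric] by (simp add: A_def abc ac_simps)
  show "Im (A * B * B * D) < 0"
    unfolding 2 using bd abc' ac by (simp add: algebra_simps)
  have 4: "A * A * B * D = Complex (-192) (2 * a) * (Complex 1 b * Complex 1 c)"
    unfolding AA[symmetric] by (simp add: B_def D_def abc ac_simps)
  show "Im (A * A * B * D) < 0"
    unfolding 4 using bd abc' ac by (simp add: algebra_simps)
  have 3: "A * A * B * B = Complex (-192) (2 * a) * Complex (-32) (2 * b)"
    unfolding AA[symmetric] BB[symmetric] by (simp add: ac_simps)
  show "Im (A * A * B * B) < 0"
    unfolding 3 using bd by simp
qed

text \<open>\<open>e\<close> is the fan around one inner vertex, from the spike edge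
  \<open>e 0\<close> to a second inner vertex reached along \<open>e 4\<close>. \<open>g\<close> is
  the fan around that second vertex; \<open>g 0\<close> looks back to the first and
  \<open>g 3\<close> runs to the third. The conclusion says that the last ring edge crosses the
  spike edge.\<close>

lemma two_fan_crossing:
  fixes e g :: "nat \<Rightarrow> complex"
  assumes ne: "(cmod (e 0))\<^sup>2 = 97" "(cmod (e 1))\<^sup>2 = 2" "(cmod (e 2))\<^sup>2 = 17"
      "(cmod (e 3))\<^sup>2 = 17" "(cmod (e 4))\<^sup>2 = 2"
    and ng: "(cmod (g 1))\<^sup>2 = 17" "(cmod (g 2))\<^sup>2 = 17" "(cmod (g 3))\<^sup>2 = 2"
    and g: "g 0 = - e 4" "g 1 = e 3 - e 4"
    and oe: "\<And>i. i < 4 \<Longrightarrow> Re (cnj (e i) * e (Suc i)) = 1"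
    and og: "\<And>i. i < 3 \<Longrightarrow> Re (cnj (g i) * g (Suc i)) = 1"
    and te: "\<And>i. i < 3 \<Longrightarrow>
      Im (cnj (e i) * e (Suc i)) * Im (cnj (e (Suc i)) * e (Suc (Suc i))) > 0"
    and tg: "\<And>i. i < 2 \<Longrightarrow>
      Im (cnj (g i) * g (Suc i)) * Im (cnj (g (Suc i)) * g (Suc (Suc i))) > 0"
  shows "\<exists>l r. 0 < l \<and> l < 1 \<and> 0 < r \<and> r < 1 \<and> e 4 + of_real l * g 3 = of_real r * e 0"
proof -
  have pos: "\<exists>l r. 0 < l \<and> l < 1 \<and> 0 < r \<and> r < 1 \<and> e 4 + of_real l * g 3 = of_real r * e 0"
    if ne: "(cmod (e 0))\<^sup>2 = 97" "(cmod (e 1))\<^sup>2 = 2" "(cmod (e 2))\<^sup>2 = 17"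
      "(cmod (e 3))\<^sup>2 = 17" "(cmod (e 4))\<^sup>2 = 2"
    and ng: "(cmod (g 1))\<^sup>2 = 17" "(cmod (g 2))\<^sup>2 = 17" "(cmod (g 3))\<^sup>2 = 2"
    and g: "g 0 = - e 4"
    and oe: "\<And>i. i < 4 \<Longrightarrow> Re (cnj (e i) * e (Suc i)) = 1"
    and og: "\<And>i. i < 3 \<Longrightarrow> Re (cnj (g i) * g (Suc i)) = 1"
    and pe: "\<And>i. i < 4 \<Longrightarrow> Im (cnj (e i) * e (Suc i)) > 0"
    and pg: "\<And>i. i < 3 \<Longrightarrow> Im (cnj (g i) * g (Suc i)) > 0"
    for e g :: "nat \<Rightarrow> complex"
  proof -
    define a b c where abc: "a = sqrt 193" "b = sqrt 33" "c = sqrt 288"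
    note bd = sqrt_bounds[folded abc]
    have step: "v = u * Complex 1 (sqrt (n * n' - 1)) / of_real n"
      if "(cmod u)\<^sup>2 = n" "(cmod v)\<^sup>2 = n'" "n > 0" "Re (cnj u * v) = 1" "Im (cnj u * v) > 0"
      for u v n n'
    proof -
      have "(Im (cnj u * v))\<^sup>2 = n * n' - 1" unfolding Im_cnj_mult_sq that by simp
      then have "Im (cnj u * v) = sqrt (n * n' - 1)" using that(5)
        by (metis less_imp_le real_sqrt_unique)
      then show ?thesis using complex_step[OF that(1,3,4)] by simp
    qed
    have ng0: "(cmod (g 0))\<^sup>2 = 2" using ne(5) g by simp
    have e1: "e 1 = e 0 * Complex 1 a / 97"
      using step[OF ne(1,2)] oe[of 0] pe[of 0] by (simp add: abc)
    have e2: "e 2 = e 1 * Complex 1 b / 2"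
      using step[OF ne(2,3)] oe[of 1] pe[of 1] by (simp add: abc numeral_2_eq_2)
    have e3: "e 3 = e 2 * Complex 1 c / 17"
      using step[OF ne(3,4)] oe[of 2] pe[of 2] by (simp add: abc eval_nat_numeral)
    have e4: "e 4 = e 3 * Complex 1 b / 17"
      using step[OF ne(4,5)] oe[of 3] pe[of 3] by (simp add: abc eval_nat_numeral)
    have g1: "g 1 = g 0 * Complex 1 b / 2"
      using step[OF ng0 ng(1)] og[of 0] pg[of 0] by (simp add: abc)
    have g2: "g 2 = g 1 * Complex 1 c / 17"
      using step[OF ng(1,2)] og[of 1] pg[of 1] by (simp add: abc numeral_2_eq_2)
    have g3: "g 3 = g 2 * Complex 1 b / 17"
      using step[OF ng(2,3)] og[of 2] pg[of 2] by (simp add: abc eval_nat_numeral)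
    \<comment> \<open>\<open>W\<close> is the turn through three brim sectors, which both fans make.
      The denominators below are products of squared lengths: 56066 = 97 * 2 * 17 * 17 and 578 = 2 *
      17 * 17.\<close>
    define x y where xy: "x = - 32 - 2 * (b * c)" "y = 2 * b - 32 * c"
    define W where "W = Complex x y"
    have W: "W = Complex 1 b * Complex 1 c * Complex 1 b"
    proof -
      have "b * b = 33" by (simp add: abc)
      then have "b * (b * c) = 33 * c" by (metis mult.assoc)
      with \<open>b * b = 33\<close> show ?thesis
        unfolding W_def xy by (simp add: complex_eq_iff algebra_simps)
    qed
    have e4': "e 4 = e 0 * (Complex 1 a * W) / 56066"
      unfolding e4 e3 e2 e1 W by (simp add: ac_simps)
    have g3': "g 3 = - e 4 * W / 578"
      unfolding g3 g2 g1 g W by (simp add: ac_simps)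
    have "5.74 * 16.97 < b * c" "b * c < 5.75 * 16.98"
      by (rule mult_strict_mono; use bd in auto)+
    then have x: "- 227.28 < x" "x < - 226.8" and y: "- 531.88 < y" "y < - 531.54"
      using bd by (auto simp: xy)
    have x2: "226.8 * 226.8 < x * x" "x * x < 227.28 * 227.28"
      using mult_strict_mono'[of "226.8" "-x" "226.8" "-x"] mult_strict_mono'[of "-x" "227.28" "-x" "227.28"] x
      by auto
    have y2: "531.54 * 531.54 < y * y" "y * y < 531.88 * 531.88"
      using mult_strict_mono'[of "531.54" "-y" "531.54" "-y"] mult_strict_mono'[of "-y" "531.88" "-y" "531.88"] y
      by auto
    have xy2: "226.8 * 531.54 < x * y" "x * y < 227.28 * 531.88"
      using mult_strict_mono'[of "226.8" "-x" "531.54" "-y"] mult_strict_mono'[of "-x" "227.28" "-y" "531.88"] x y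
      by auto
    define p q where "p = y + a * x" and "q = 2 * (x * y) + a * (x * x - y * y)"
    have Im1: "Im (Complex 1 a * W) = p" and Im2: "Im (Complex 1 a * W * W) = q"
      by (simp_all add: W_def p_def q_def algebra_simps)
    have Re1: "Re (Complex 1 a * W) = x - a * y"
      and Re2: "Re (Complex 1 a * W * W) = x * x - y * y - 2 * (a * (x * y))"
      by (simp_all add: W_def algebra_simps)
    have ax: "13.89 * 226.8 < a * (- x)" "a * (- x) < 13.9 * 227.28"
      by (rule mult_strict_mono; use bd x in auto)+
    have ay: "13.89 * 531.54 < a * (- y)" "a * (- y) < 13.9 * 531.88"
      by (rule mult_strict_mono; use bd y in auto)+
    have aq: "13.89 * (531.54 * 531.54 - 227.28 * 227.28) < a * (y * y - x * x)"
      by (rule mult_strict_mono; use bd x2 y2 in auto)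
    have axy: "13.89 * (226.8 * 531.54) < a * (x * y)" "a * (x * y) < 13.9 * (227.28 * 531.88)"
      by (rule mult_strict_mono; use bd xy2 in auto)+
    have p: "p < 0" and pq: "q < 578 * p"
      using ax aq xy2 x y by (simp_all add: p_def q_def algebra_simps)
    \<comment> \<open>\<open>l\<close> is the parameter at which \<open>e 4 + l * g 3\<close>
      becomes a real multiple of \<open>e 0\<close>: it makes the imaginary part of \<open>z\<close>
      below vanish. The remaining work is to locate that real multiple between 0 and 1.\<close>
    define l where "l = 578 * p / q"
    have l: "0 < l" "l < 1" and lq: "l * q = 578 * p"
      using p pq by (auto simp: l_def field_simps)
    define z where "z = Complex 1 a * W * (1 - of_real (l / 578) * W)"
    have z: "z = Complex 1 a * W - of_real (l / 578) * (Complex 1 a * W * W)"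
      by (simp add: z_def algebra_simps)
    have scale: "Im (of_real t * v) = t * Im v" "Re (of_real t * v) = t * Re v" for t v
      by simp_all
    have "Im z = p - l / 578 * q" unfolding z minus_complex.sel scale Im1 Im2 ..
    then have Imz: "Im z = 0" using lq by simp
    define R where "R = x * x - y * y - 2 * (a * (x * y))"
    have Rez: "Re z = (x - a * y) - l / 578 * R"
      unfolding z minus_complex.sel scale Re1 Re2 R_def ..
    \<comment> \<open>A generous bound: 5000000 / 578 is below 9000 and the other part of
      \<open>Re z\<close> is below 8000, whereas 56066 is allowed.\<close>
    have R: "- 5000000 < R" "R < 0"
      using x2 y2 axy by (auto simp: R_def algebra_simps)
    have "l * (- R) < 1 * 5000000"
      by (rule mult_strict_mono; use l R in auto)
    moreover have "l * R < 0" using l R by (simp add: mult_less_0_iff)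
    ultimately have "0 < Re z" "Re z < 56066" using ay x unfolding Rez by auto
    moreover have "e 4 + of_real l * g 3 = of_real (Re z / 56066) * e 0"
    proof -
      have "e 4 + of_real l * g 3 = e 0 * z / 56066"
        unfolding g3' e4' z_def by (simp add: field_simps)
      also have "z = of_real (Re z)" using Imz by (simp add: complex_eq_iff)
      finally show ?thesis by (simp add: mult.commute)
    qed
    ultimately show ?thesis using l by (intro exI[of _ l] exI[of _ "Re z / 56066"]) auto
  qed
  \<comment> \<open>The last sector of \<open>e\<close> and the first of \<open>g\<close> are two
    corners of the same triangle, so both fans turn the same way.\<close>
  have ge: "Im (cnj (g 0) * g 1) = Im (cnj (e 3) * e 4)"
    unfolding g by (simp add: algebra_simps)
  have "(\<forall>i<4. Im (cnj (e i) * e (Suc i)) > 0) \<and> (\<forall>i<3. Im (cnj (g i) * g (Suc i)) > 0) \<or>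
    (\<forall>i<4. Im (cnj (e i) * e (Suc i)) < 0) \<and> (\<forall>i<3. Im (cnj (g i) * g (Suc i)) < 0)"
    using te[of 0] te[of 1] te[of 2] tg[of 0] tg[of 1] ge
    by (auto simp: eval_nat_numeral less_Suc_eq zero_less_mult_iff)
  then consider "(\<forall>i<4. Im (cnj (e i) * e (Suc i)) > 0)" "(\<forall>i<3. Im (cnj (g i) * g (Suc i)) > 0)"
    | "(\<forall>i<4. Im (cnj (e i) * e (Suc i)) < 0)" "(\<forall>i<3. Im (cnj (g i) * g (Suc i)) < 0)"
    by blast
  then show ?thesis
  proof cases
    case 1
    then show ?thesis using pos[OF ne ng g(1) oe og] by blast
  next
    case 2
    have "\<exists>l r. 0 < l \<and> l < 1 \<and> 0 < r \<and> r < 1 \<and>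
      cnj (e 4) + of_real l * cnj (g 3) = of_real r * cnj (e 0)"
    proof (rule pos)
      show "Re (cnj (cnj (e i)) * cnj (e (Suc i))) = 1" if "i < 4" for i
        using oe[OF that] by simp
      show "Re (cnj (cnj (g i)) * cnj (g (Suc i))) = 1" if "i < 3" for i
        using og[OF that] by simp
      show "Im (cnj (cnj (e i)) * cnj (e (Suc i))) > 0" if "i < 4" for i
        using 2 that by (auto simp: algebra_simps)
      show "Im (cnj (cnj (g i)) * cnj (g (Suc i))) > 0" if "i < 3" for i
        using 2 that by (auto simp: algebra_simps)
    qed (use ne ng g(1) in simp_all)
    then show ?thesis
      by (metis complex_cnj_add complex_cnj_cnj complex_cnj_complex_of_real complex_cnj_mult)
  qed
qed

subsection \<open>Layouts of triangle complexes\<close>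

definition cplx :: "real^2 \<Rightarrow> complex" where
  "cplx x = Complex (x $ 1) (x $ 2)"

lemma cplx_linear:
  "cplx (x + y) = cplx x + cplx y" "cplx (x - y) = cplx x - cplx y"
  "cplx (r *\<^sub>R x) = of_real r * cplx x"
  by (simp_all add: cplx_def complex_eq_iff)

lemma cmod_cplx: "cmod (cplx x) = norm x"
  by (simp add: cplx_def norm_vec_def L2_set_def sum_2 cmod_def)

lemma cplx_eq_iff: "cplx x = cplx y \<longleftrightarrow> x = y"
  by (auto simp: cplx_def vec_eq_iff forall_2)

text \<open>Leibniz's formula. Its right-hand side mentions distances only, so the same value
  results before and after an isometry.\<close>

lemma norm_barycentric:
  fixes a b c x :: "'a::real_inner"
  assumes "u + v + w = 1"
  shows "(norm (x - (u *\<^sub>R a + v *\<^sub>R b + w *\<^sub>R c)))\<^sup>2 =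
    u * (dist x a)\<^sup>2 + v * (dist x b)\<^sup>2 + w * (dist x c)\<^sup>2
    - u * v * (dist a b)\<^sup>2 - u * w * (dist a c)\<^sup>2 - v * w * (dist b c)\<^sup>2"
proof -
  have u: "u = 1 - v - w" using assms by simp
  have id: "(norm (u *\<^sub>R p + v *\<^sub>R q + w *\<^sub>R r))\<^sup>2 =
    u * (norm p)\<^sup>2 + v * (norm q)\<^sup>2 + w * (norm r)\<^sup>2
    - u * v * (norm (p - q))\<^sup>2 - u * w * (norm (p - r))\<^sup>2 - v * w * (norm (q - r))\<^sup>2"
    for p q r :: 'a
    unfolding u power2_norm_eq_inner by (simp add: inner_simps inner_commute algebra_simps)
  have "x - (u *\<^sub>R a + v *\<^sub>R b + w *\<^sub>R c) = u *\<^sub>R (x - a) + v *\<^sub>R (x - b) + w *\<^sub>R (x - c)"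
    unfolding u by (simp add: algebra_simps)
  then show ?thesis
    using id[of "x - a" "x - b" "x - c"] by (simp add: dist_norm norm_minus_commute)
qed

text \<open>Layout maps are given as isometries, not as affine maps. By Leibniz's formula the image
  of a barycentric combination has distance 0 from the combination of the images.\<close>

lemma isometry_barycentric:
  fixes A :: "'a::real_inner \<Rightarrow> 'b::real_inner"
  assumes iso: "\<And>x y. x \<in> S \<Longrightarrow> y \<in> S \<Longrightarrow> dist (A x) (A y) = dist x y"
    and S: "a \<in> S" "b \<in> S" "c \<in> S" "u *\<^sub>R a + v *\<^sub>R b + w *\<^sub>R c \<in> S" and 1: "u + v + w = 1"
  shows "A (u *\<^sub>R a + v *\<^sub>R b + w *\<^sub>R c) = u *\<^sub>R A a + v *\<^sub>R A b + w *\<^sub>R A c"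
proof -
  let ?x = "u *\<^sub>R a + v *\<^sub>R b + w *\<^sub>R c"
  have "(norm (A ?x - (u *\<^sub>R A a + v *\<^sub>R A b + w *\<^sub>R A c)))\<^sup>2 = (norm (?x - ?x))\<^sup>2"
    unfolding norm_barycentric[OF 1] using iso S by simp
  then show ?thesis by simp
qed

lemma convex_hull_3_iff:
  "x \<in> convex hull {a, b, c} \<longleftrightarrow>
    (\<exists>u v w. 0 \<le> u \<and> 0 \<le> v \<and> 0 \<le> w \<and> u + v + w = 1 \<and> x = u *\<^sub>R a + v *\<^sub>R b + w *\<^sub>R c)"
  unfolding convex_hull_3 by blast

text \<open>Degree and crossing bounds for a single hat are proved here for layouts in any number of
  pieces; connectedness enters with \<open>one_piece_net\<close>.\<close>

locale net =
  fixes pos :: "nat \<Rightarrow> real^3" and F C :: "nat set set" and A :: "nat set \<Rightarrow> real^3 \<Rightarrow> real^2"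
  assumes face: "\<And>f. f \<in> F \<Longrightarrow> card f = 3 \<and> \<not> collinear (pos ` f)"
    and embedded: "\<And>f g. f \<in> F \<Longrightarrow> g \<in> F \<Longrightarrow> tri pos f \<inter> tri pos g = tri pos (f \<inter> g)"
    and isometric: "\<And>f x y. f \<in> F \<Longrightarrow> x \<in> tri pos f \<Longrightarrow> y \<in> tri pos f \<Longrightarrow>
      dist (A f x) (A f y) = dist x y"
    and agree: "\<And>f g x. uncut_adj F C f g \<Longrightarrow> x \<in> tri pos (f \<inter> g) \<Longrightarrow> A f x = A g x"
    and no_overlap: "\<And>f g x y. f \<in> F \<Longrightarrow> g \<in> F \<Longrightarrow> x \<in> tri pos f \<Longrightarrow> y \<in> tri pos g \<Longrightarrow>
      A f x = A g y \<Longrightarrow> x = y"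
begin

definition img :: "nat set \<Rightarrow> nat \<Rightarrow> complex" where
  "img f v = cplx (A f (pos v))"

lemma pos_in_tri: "v \<in> f \<Longrightarrow> pos v \<in> tri pos f"
  unfolding tri_def by (simp add: hull_inc)

lemma dist_img:
  "f \<in> F \<Longrightarrow> a \<in> f \<Longrightarrow> b \<in> f \<Longrightarrow> cmod (img f a - img f b) = dist (pos a) (pos b)"
  unfolding img_def cplx_linear[symmetric] cmod_cplx
  using isometric pos_in_tri by (simp add: dist_norm[symmetric])

lemma img_agree: "uncut_adj F C f g \<Longrightarrow> v \<in> f \<Longrightarrow> v \<in> g \<Longrightarrow> img f v = img g v"
  unfolding img_def using agree[of f g "pos v"] pos_in_tri[of v "f \<inter> g"] by simp

lemma img_barycentric:
  assumes f: "{a, b, c} \<in> F" and "0 \<le> u" "0 \<le> v" "0 \<le> w" and 1: "u + v + w = 1"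
  shows "cplx (A {a, b, c} (u *\<^sub>R pos a + v *\<^sub>R pos b + w *\<^sub>R pos c)) =
    of_real u * img {a, b, c} a + of_real v * img {a, b, c} b + of_real w * img {a, b, c} c"
proof -
  have "u *\<^sub>R pos a + v *\<^sub>R pos b + w *\<^sub>R pos c \<in> tri pos {a, b, c}"
    unfolding tri_def using assms by (auto simp: convex_hull_3_iff)
  then have "A {a, b, c} (u *\<^sub>R pos a + v *\<^sub>R pos b + w *\<^sub>R pos c) =
      u *\<^sub>R A {a, b, c} (pos a) + v *\<^sub>R A {a, b, c} (pos b) + w *\<^sub>R A {a, b, c} (pos c)"
    by (intro isometry_barycentric[OF isometric[OF f]] 1) (auto intro: pos_in_tri)
  then show ?thesis by (simp add: img_def cplx_linear)
qed

text \<open>Coincidence in the plane forces the same point of the surface; by embeddedness that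
  point lies in the hull of the common vertices, hence on the side opposite \<open>c\<close>. Each
  later contradiction from an overlap exhibits a common image point with positive weight at a vertex
  foreign to the other face.\<close>

lemma overlap_coefficient_zero:
  assumes f: "{a, b, c} \<in> F" and g: "{a', b', c'} \<in> F" and c: "c \<notin> {a', b', c'}"
    and u: "0 \<le> u" "0 \<le> v" "0 \<le> w" "u + v + w = 1"
    and u': "0 \<le> u'" "0 \<le> v'" "0 \<le> w'" "u' + v' + w' = 1"
    and eq: "of_real u * img {a, b, c} a + of_real v * img {a, b, c} b + of_real w * img {a, b, c} c
      = of_real u' * img {a', b', c'} a' + of_real v' * img {a', b', c'} b' + of_real w' * img {a', b', c'} c'"
  shows "w = 0"
proof (rule ccontr)
  assume w: "w \<noteq> 0"
  let ?x = "u *\<^sub>R pos a + v *\<^sub>R pos b + w *\<^sub>R pos c"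
  let ?y = "u' *\<^sub>R pos a' + v' *\<^sub>R pos b' + w' *\<^sub>R pos c'"
  have x: "?x \<in> tri pos {a, b, c}" unfolding tri_def using u by (auto simp: convex_hull_3_iff)
  have y: "?y \<in> tri pos {a', b', c'}" unfolding tri_def using u' by (auto simp: convex_hull_3_iff)
  have "A {a, b, c} ?x = A {a', b', c'} ?y"
    using eq unfolding img_barycentric[OF f u, symmetric] img_barycentric[OF g u', symmetric]
      cplx_eq_iff .
  then have "?x = ?y" by (rule no_overlap[OF f g x y])
  then have "?x \<in> tri pos ({a, b, c} \<inter> {a', b', c'})"
    using embedded[OF f g] x y by auto
  also have "\<dots> \<subseteq> tri pos {a, b}" unfolding tri_def using c by (intro hull_mono) auto
  finally obtain s where s: "?x = (1 - s) *\<^sub>R pos a + s *\<^sub>R pos b"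
    unfolding tri_def by (auto simp: segment_convex_hull[symmetric] in_segment)
  have u1: "u = 1 - v - w" using u by simp
  have "w *\<^sub>R (pos c - pos a) = (s - v) *\<^sub>R (pos b - pos a)"
    using s unfolding u1 by (simp add: algebra_simps)
  then have "(1 / w) *\<^sub>R (w *\<^sub>R (pos c - pos a)) = (1 / w) *\<^sub>R ((s - v) *\<^sub>R (pos b - pos a))"
    by simp
  then have "pos c - pos a = ((s - v) / w) *\<^sub>R (pos b - pos a)" using w by simp
  then have "collinear {pos b, pos a, pos c}"
    by (subst collinear_3) (auto simp: collinear_lemma)
  then show False using face[OF f] by (simp add: insert_commute)
qed

lemma img_dot:
  assumes "f \<in> F" "a \<in> f" "b \<in> f" "c \<in> f"
  shows "Re (cnj (img f b - img f a) * (img f c - img f a)) =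
    ((dist (pos a) (pos b))\<^sup>2 + (dist (pos a) (pos c))\<^sup>2 - (dist (pos b) (pos c))\<^sup>2) / 2"
proof -
  have polar: "Re (cnj u * v) = ((cmod u)\<^sup>2 + (cmod v)\<^sup>2 - (cmod (u - v))\<^sup>2) / 2" for u v
    unfolding cmod_power2 by (simp add: power2_eq_square algebra_simps)
  show ?thesis
    unfolding polar using dist_img[of f b a] dist_img[of f c a] dist_img[of f b c] assms by (simp add: dist_commute)
qed

text \<open>A vanishing cross product would be equality in the Cauchy-Schwarz inequality for the
  original edge vectors.\<close>

lemma img_noncollinear:
  assumes f: "{w, b, a} \<in> F"
  shows "Im (cnj (img {w, b, a} b - img {w, b, a} w) * (img {w, b, a} a - img {w, b, a} w)) \<noteq> 0"
proof
  let ?f = "{w, b, a}"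
  let ?B = "img ?f b - img ?f w" and ?A = "img ?f a - img ?f w"
  let ?b = "pos b - pos w" and ?a = "pos a - pos w"
  assume "Im (cnj ?B * ?A) = 0"
  then have "(cmod ?B)\<^sup>2 * (cmod ?A)\<^sup>2 = (Re (cnj ?B * ?A))\<^sup>2"
    using Im_cnj_mult_sq[of ?B ?A] by simp
  moreover have "Re (cnj ?B * ?A) =
      ((dist (pos w) (pos b))\<^sup>2 + (dist (pos w) (pos a))\<^sup>2 - (dist (pos b) (pos a))\<^sup>2) / 2"
    by (rule img_dot[OF f]) auto
  moreover have "\<dots> = ?b \<bullet> ?a"
    by (simp add: dist_norm power2_norm_eq_inner inner_simps inner_commute field_simps)
  moreover have "cmod ?B = norm ?b" "cmod ?A = norm ?a"
    using dist_img[OF f, of b w] dist_img[OF f, of a w] by (auto simp: dist_norm)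
  ultimately have "(?b \<bullet> ?a)\<^sup>2 = (norm ?b * norm ?a)\<^sup>2" by (simp add: power_mult_distrib)
  then have "\<bar>?b \<bullet> ?a\<bar> = norm ?b * norm ?a"
    by (metis real_sqrt_abs abs_of_nonneg mult_nonneg_nonneg norm_ge_zero)
  then have "collinear {0, ?b, ?a}" by (simp add: norm_cauchy_schwarz_equal)
  then have "collinear {pos b, pos w, pos a}" by (subst collinear_3) (simp_all add: NO_MATCH_def)
  then show False using face[OF f] by (simp add: insert_commute)
qed

text \<open>Two glued triangles on the same side of their common edge would share image points just
  off its midpoint.\<close>

lemma opposite_sides:
  assumes f: "{w, b, a} \<in> F" and g: "{w, b, d} \<in> F"
    and adj: "uncut_adj F C {w, b, a} {w, b, d}"
  shows "Im (cnj (img {w, b, a} b - img {w, b, a} w) * (img {w, b, a} a - img {w, b, a} w))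
    * Im (cnj (img {w, b, d} b - img {w, b, d} w) * (img {w, b, d} d - img {w, b, d} w)) < 0"
proof (rule ccontr)
  let ?f = "{w, b, a}" and ?g = "{w, b, d}"
  define W B X Y where d: "W = img ?f w" "B = img ?f b - W" "X = img ?f a - W" "Y = img ?g d - W"
  have gw: "img ?g w = W" "img ?g b = B + W"
    using img_agree[OF adj, of w] img_agree[OF adj, of b] by (auto simp: d)
  have nz: "Im (cnj B * X) \<noteq> 0" "Im (cnj B * Y) \<noteq> 0"
    using img_noncollinear[OF f] img_noncollinear[OF g] gw by (auto simp: d)
  assume "\<not> ?thesis"
  then have "\<not> Im (cnj B * X) * Im (cnj B * Y) < 0" using gw by (simp add: d)
  with nz have pos: "Im (cnj B * X) * Im (cnj B * Y) > 0"
    by (metis linorder_neqE_linordered_idom mult_eq_0_iff)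
  define q where "q = Im (cnj B * Y) / Im (cnj B * X)"
  define p where "p = Im (cnj Y * X) / Im (cnj B * X)"
  have q: "q > 0" using pos by (auto simp: q_def zero_less_mult_iff zero_less_divide_iff)
  have "of_real (Im (cnj B * X)) * Y = of_real (Im (cnj Y * X)) * B + of_real (Im (cnj B * Y)) * X"
    by (simp add: complex_eq_iff algebra_simps)
  then have "Y = (of_real (Im (cnj Y * X)) * B + of_real (Im (cnj B * Y)) * X) / of_real (Im (cnj B * X))"
    using nz(1) by (metis nonzero_mult_div_cancel_left of_real_eq_0_iff)
  then have Y: "Y = of_real p * B + of_real q * X"
    unfolding p_def q_def of_real_divide by (simp only: add_divide_distrib times_divide_eq_left)
  \<comment> \<open>\<open>p\<close> and \<open>q\<close> are the coordinates of \<open>Y\<close> in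
    the basis \<open>B\<close>, \<open>X\<close>. The common point is reached from the midpoint of
    the edge by going the fraction \<open>h\<close> of the way to \<open>d\<close>; this
    \<open>h\<close> is small enough to keep its three weights in the first face
    nonnegative.\<close>
  define h where "h = 1 / (1 + 2 * \<bar>p\<bar> + 2 * q)"
  have h: "h > 0" "h * (1 + 2 * \<bar>p\<bar> + 2 * q) = 1"
    using q by (auto simp: h_def)
  define P where "P = h * \<bar>p\<bar>"
  have hp: "h * p \<le> P" "- (h * p) \<le> P" "0 < h * q" "0 \<le> P"
    using h q mult_left_mono[of p "\<bar>p\<bar>" h] mult_left_mono[of "- p" "\<bar>p\<bar>" h]
    by (auto simp: P_def)
  have h1: "h + 2 * P + 2 * (h * q) = 1" using h(2) by (simp add: P_def algebra_simps)
  have ad: "a \<noteq> d" using adj by (auto simp: uncut_adj_def)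
  have card: "card ?f = 3" "card ?g = 3" using face f g by auto
  have dn: "d \<notin> ?f" using ad card by (auto simp: card_insert_if split: if_splits)
  have "h = 0"
  proof (rule overlap_coefficient_zero[OF g f dn])
    show "0 \<le> (1 - h) / 2" "0 \<le> (1 - h) / 2" "0 \<le> h" "(1 - h) / 2 + (1 - h) / 2 + h = 1"
      using h1 hp h(1) by (simp_all add: field_simps)
    show "0 \<le> (1 - h) / 2 + h - h * p - h * q" "0 \<le> (1 - h) / 2 + h * p" "0 \<le> h * q"
      "((1 - h) / 2 + h - h * p - h * q) + ((1 - h) / 2 + h * p) + h * q = 1"
      using h1 hp h(1) by (simp_all add: field_simps)
    have i: "img ?f b = B + W" "img ?f a = X + W" "img ?f w = W" "img ?g d = Y + W" by (auto simp: d)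
    show "of_real ((1 - h) / 2) * img ?g w + of_real ((1 - h) / 2) * img ?g b + of_real h * img ?g d =
      of_real ((1 - h) / 2 + h - h * p - h * q) * img ?f w + of_real ((1 - h) / 2 + h * p) * img ?f b
        + of_real (h * q) * img ?f a"
      unfolding gw i Y by (simp add: field_simps)
  qed
  then show False using h by simp
qed

text \<open>\<open>e i\<close> is the spoke to \<open>n i\<close>, measured from the image of
  \<open>w\<close>. The last clause says that all sectors turn the same way, so that their angles
  add up.\<close>

definition fan_layout :: "nat \<Rightarrow> nat \<Rightarrow> (nat \<Rightarrow> nat) \<Rightarrow> (nat \<Rightarrow> real) \<Rightarrow> (nat \<Rightarrow> complex) \<Rightarrow> bool" where
  "fan_layout m w n N e \<longleftrightarrow>
    (\<forall>i<m. img {w, n i, n (Suc i)} w = img {w, n 0, n (Suc 0)} w \<and>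
      img {w, n i, n (Suc i)} (n i) = img {w, n 0, n (Suc 0)} w + e i \<and>
      img {w, n i, n (Suc i)} (n (Suc i)) = img {w, n 0, n (Suc 0)} w + e (Suc i) \<and>
      Re (cnj (e i) * e (Suc i)) = 1) \<and>
    (\<forall>i\<le>m. (cmod (e i))\<^sup>2 = N i) \<and>
    (\<forall>i. Suc i < m \<longrightarrow>
      Im (cnj (e i) * e (Suc i)) * Im (cnj (e (Suc i)) * e (Suc (Suc i))) > 0)"

text \<open>The condition on the base lengths says that consecutive spokes have inner product 1, which
  happens around every inner vertex of a hat.\<close>

lemma fan:
  fixes n :: "nat \<Rightarrow> nat" and w m :: nat
  defines "f \<equiv> \<lambda>i. {w, n i, n (Suc i)}"
  assumes F: "\<And>i. i < m \<Longrightarrow> f i \<in> F"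
    and uncut: "\<And>i. Suc i < m \<Longrightarrow> {w, n (Suc i)} \<notin> C"
    and ne: "\<And>i. Suc i < m \<Longrightarrow> n i \<noteq> n (Suc (Suc i))"
    and len: "\<And>i. i \<le> m \<Longrightarrow> (dist (pos w) (pos (n i)))\<^sup>2 = N i"
    and base: "\<And>i. i < m \<Longrightarrow> (dist (pos (n i)) (pos (n (Suc i))))\<^sup>2 = N i + N (Suc i) - 2"
    and "m > 0"
  shows "\<exists>e. fan_layout m w n N e"
proof -
  define O' where "O' = img (f 0) w"
  have ws: "w \<noteq> n i" "w \<noteq> n (Suc i)" "n i \<noteq> n (Suc i)" if "i < m" for i
    using face[OF F[OF that]] unfolding f_def by (auto simp: card_insert_if split: if_splits)
  have int: "f i \<inter> f (Suc i) = {w, n (Suc i)}" if "Suc i < m" for i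
    using ws[of i] ws[of "Suc i"] ne[OF that] that unfolding f_def by auto
  have adj: "uncut_adj F C (f i) (f (Suc i))" if "Suc i < m" for i
  proof -
    have "n i \<notin> f (Suc i)" using ws[of i] ne[OF that] that unfolding f_def by auto
    then have "f i \<noteq> f (Suc i)" unfolding f_def by blast
    then show ?thesis
      unfolding uncut_adj_def int[OF that] using F uncut that ws(2)[of i] by simp
  qed
  have center: "i < m \<longrightarrow> img (f i) w = O'" for i
  proof (induction i)
    case (Suc i)
    then show ?case using img_agree[OF adj, of i w] by (auto simp: f_def)
  qed (simp add: O'_def)
  \<comment> \<open>No face of the fan starts at \<open>n m\<close>, so \<open>e m\<close> is read
    off the last face. In a full turn \<open>n m\<close> and \<open>n 0\<close> are one vertex, but
    if its spoke is cut, \<open>e m\<close> and \<open>e 0\<close> may differ.\<close>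
  define e where "e i = (if i < m then img (f i) (n i) - O' else img (f (m - 1)) (n m) - O')" for i
  have e1: "img (f i) (n i) = O' + e i" if "i < m" for i using that by (simp add: e_def)
  have e2: "img (f i) (n (Suc i)) = O' + e (Suc i)" if "i < m" for i
  proof (cases "Suc i < m")
    case True
    then show ?thesis using img_agree[OF adj, of i "n (Suc i)"] by (auto simp: e_def f_def)
  next
    case False
    then have "m = Suc i" using that by simp
    then show ?thesis by (simp add: e_def)
  qed
  have vec: "e i = img (f i) (n i) - img (f i) w" "e (Suc i) = img (f i) (n (Suc i)) - img (f i) w"
    if "i < m" for i using e1 e2 center that by auto
  have fold: "{w, n i, n (Suc i)} = f i" for i by (simp add: f_def)
  have "fan_layout m w n N e"
    unfolding fan_layout_def fold
  proof (intro conjI allI impI)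
    show "img (f i) w = img (f 0) w" if "i < m" for i unfolding O'_def[symmetric] using center that by simp
    show "img (f i) (n i) = img (f 0) w + e i" if "i < m" for i unfolding O'_def[symmetric] using e1 that by simp
    show "img (f i) (n (Suc i)) = img (f 0) w + e (Suc i)" if "i < m" for i
      unfolding O'_def[symmetric] using e2 that by simp
    show "(cmod (e i))\<^sup>2 = N i" if "i \<le> m" for i
    proof (cases "i < m")
      case True
      then show ?thesis unfolding vec(1)[OF True]
        using dist_img[OF F[OF True], of "n i" w] len[OF that] by (simp add: f_def dist_commute)
    next
      case False
      then have "i = Suc (m - 1)" "m - 1 < m" using that assms(7) by auto
      then obtain k where k: "i = Suc k" "k < m" by blast
      show ?thesis unfolding k(1) vec(2)[OF k(2)]
        using dist_img[OF F[OF k(2)], of "n (Suc k)" w] len[OF that] k(1)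
        by (simp add: f_def dist_commute)
    qed
    show "Re (cnj (e i) * e (Suc i)) = 1" if i: "i < m" for i
      unfolding vec[OF i] using img_dot[OF F[OF i], of w "n i" "n (Suc i)"] len[of i] len[of "Suc i"]
        base[OF i] i by (simp add: f_def)
    show "Im (cnj (e i) * e (Suc i)) * Im (cnj (e (Suc i)) * e (Suc (Suc i))) > 0" if i: "Suc i < m" for i
    proof -
      let ?a = "n i" and ?b = "n (Suc i)" and ?d = "n (Suc (Suc i))"
      have eqs: "f i = {w, ?b, ?a}" "f (Suc i) = {w, ?b, ?d}"
        unfolding f_def by auto
      have v: "e i = img {w, ?b, ?a} ?a - img {w, ?b, ?a} w"
        "e (Suc i) = img {w, ?b, ?a} ?b - img {w, ?b, ?a} w"
        "e (Suc i) = img {w, ?b, ?d} ?b - img {w, ?b, ?d} w"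
        "e (Suc (Suc i)) = img {w, ?b, ?d} ?d - img {w, ?b, ?d} w"
        using vec[of i] vec[of "Suc i"] i unfolding eqs by simp_all
      have "{w, ?b, ?a} \<in> F" "{w, ?b, ?d} \<in> F"
        using F[of i] F[of "Suc i"] i unfolding eqs by simp_all
      then have "Im (cnj (e (Suc i)) * e i) * Im (cnj (e (Suc i)) * e (Suc (Suc i))) < 0"
        using opposite_sides[of w ?b ?a ?d] adj[OF i] unfolding eqs v[symmetric] by blast
      moreover have "Im (cnj (e (Suc i)) * e i) = - Im (cnj (e i) * e (Suc i))" by simp
      ultimately show ?thesis by (simp only: mult_minus_left neg_less_0_iff_less)
    qed
  qed
  then show ?thesis by blast
qed

end

section \<open>Cuts forced inside one hat: vertex degrees and the crossing spike\<close>

context net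
begin

text \<open>The five faces around w span more than a full turn, so after at most one cut the first and
  the last of them overlap along the cut spoke.\<close>

lemma negative_curvature:
  fixes n :: "nat \<Rightarrow> nat"
  assumes F: "\<And>i. i < 5 \<Longrightarrow> {w, n i, n (Suc i)} \<in> F"
    and uncut: "\<And>i. Suc i < 5 \<Longrightarrow> {w, n (Suc i)} \<notin> C"
    and n5: "n 5 = n 0"
    and ne: "\<And>i. Suc i < 5 \<Longrightarrow> n i \<noteq> n (Suc (Suc i))"
    and n41: "n 4 \<noteq> n 1"
    and len: "\<And>i. i \<le> 5 \<Longrightarrow> (dist (pos w) (pos (n i)))\<^sup>2 = N i"
    and base: "\<And>i. i < 5 \<Longrightarrow> (dist (pos (n i)) (pos (n (Suc i))))\<^sup>2 = N i + N (Suc i) - 2"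
    and N: "\<And>i. N i > 0"
    and s: "\<And>i. s i = Complex 1 (sqrt (N i * N (Suc i) - 1))"
    and Q: "Im (s 0 * s 1 * s 2 * s 3) < 0" "Im (s 0 * s 1 * s 2 * s 3 * s 4) > 0"
  shows False
proof -
  let ?f = "\<lambda>i. {w, n i, n (Suc i)}"
  have "\<exists>e. fan_layout 5 w n N e"
  proof (rule fan[of 5 w n N])
    show "{w, n i, n (Suc i)} \<in> F" if "i < 5" for i by (rule F[OF that])
    show "{w, n (Suc i)} \<notin> C" if "Suc i < 5" for i by (rule uncut[OF that])
    show "n i \<noteq> n (Suc (Suc i))" if "Suc i < 5" for i by (rule ne[OF that])
    show "(dist (pos w) (pos (n i)))\<^sup>2 = N i" if "i \<le> 5" for i by (rule len[OF that])
    show "(dist (pos (n i)) (pos (n (Suc i))))\<^sup>2 = N i + N (Suc i) - 2" if "i < 5" for i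
      by (rule base[OF that])
  qed simp
  then obtain e where e0: "fan_layout 5 w n N e" by blast
  then have e: "\<And>i. i < 5 \<Longrightarrow> img {w, n i, n (Suc i)} w = img {w, n 0, n (Suc 0)} w"
    "\<And>i. i < 5 \<Longrightarrow> img {w, n i, n (Suc i)} (n i) = img {w, n 0, n (Suc 0)} w + e i"
    "\<And>i. i < 5 \<Longrightarrow> img {w, n i, n (Suc i)} (n (Suc i)) = img {w, n 0, n (Suc 0)} w + e (Suc i)"
    "\<And>i. i \<le> 5 \<Longrightarrow> (cmod (e i))\<^sup>2 = N i"
    "\<And>i. i < 5 \<Longrightarrow> Re (cnj (e i) * e (Suc i)) = 1"
    "\<And>i. Suc i < 5 \<Longrightarrow>
      Im (cnj (e i) * e (Suc i)) * Im (cnj (e (Suc i)) * e (Suc (Suc i))) > 0"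
    unfolding fan_layout_def by blast+
  have "\<exists>m>0. \<exists>k>0. e 0 = of_real m * e 4 + of_real k * e 5"
    by (rule fan_overlap[of e N "\<lambda>i. sqrt (N i * N (Suc i) - 1)", OF e(4) N e(5) e(6) refl
          Q[unfolded s]]) auto
  then obtain m k where mk: "m > 0" "k > 0" "e 0 = of_real m * e 4 + of_real k * e 5" by blast
  \<comment> \<open>Scaling by \<open>h\<close> fits the common direction into both triangles:
    \<open>h * e 0\<close> lies on the spoke to \<open>n 0\<close> in the first face, and written in
    \<open>e 4\<close> and \<open>e 5\<close> its weights sum to less than 1, leaving weight
    \<open>h\<close> for \<open>w\<close> in the last face.\<close>
  define h where "h = 1 / (1 + m + k)"
  have h: "h > 0" "h * (1 + m + k) = 1" using mk by (auto simp: h_def)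
  have f: "?f 0 = {w, n 1, n 0}" "?f 4 = {w, n 5, n 4}" by auto
  have F': "{w, n 5, n 4} \<in> F" "{w, n 1, n 0} \<in> F"
    using F[of 4] F[of 0] unfolding f by simp_all
  have img: "img {w, n 5, n 4} w = img {w, n 1, n 0} w"
    "img {w, n 5, n 4} (n 4) = img {w, n 1, n 0} w + e 4"
    "img {w, n 5, n 4} (n 5) = img {w, n 1, n 0} w + e 5"
    "img {w, n 1, n 0} (n 0) = img {w, n 1, n 0} w + e 0"
    using e(1)[of 4] e(2)[of 4] e(3)[of 4] e(2)[of 0] unfolding f by simp_all
  have "card {w, n 5, n 4} = 3" using face[OF F'(1)] by simp
  then have n4: "n 4 \<notin> {w, n 1, n 0}"
    using n41 n5 by (auto simp: card_insert_if split: if_splits)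
  have "h * m = 0"
  proof (rule overlap_coefficient_zero[OF F'(1,2) n4])
    show "0 \<le> h" "0 \<le> h * k" "0 \<le> h * m" "h + h * k + h * m = 1"
      using h mk by (auto simp: algebra_simps)
    show "0 \<le> 1 - h" "0 \<le> (0::real)" "0 \<le> h" "1 - h + 0 + h = 1"
      using h mk mult_left_mono[of 1 "1 + m + k" h] by auto
    have "of_real h * img {w, n 1, n 0} w + of_real (h * k) * (img {w, n 1, n 0} w + e 5)
        + of_real (h * m) * (img {w, n 1, n 0} w + e 4) =
      of_real (h * (1 + m + k)) * img {w, n 1, n 0} w + of_real h * e 0"
      unfolding mk(3) by (simp add: algebra_simps)
    also have "\<dots> = img {w, n 1, n 0} w + of_real h * e 0" unfolding h(2) by simp
    finally show "of_real h * img {w, n 5, n 4} w + of_real (h * k) * img {w, n 5, n 4} (n 5)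
        + of_real (h * m) * img {w, n 5, n 4} (n 4) =
      of_real (1 - h) * img {w, n 1, n 0} w + of_real 0 * img {w, n 1, n 0} (n 1)
        + of_real h * img {w, n 1, n 0} (n 0)"
      unfolding img by (simp add: algebra_simps)
  qed
  then show False using h mk by simp
qed

end

text \<open>A hat: a brim of six triangles inside the base triangle a, b, c and a spike with tip t over the
  triangle x, y, z; the inner vertex x is the one not joined to the corner a, and so on.\<close>

definition hat :: "(nat \<Rightarrow> real^3) \<Rightarrow> nat set set \<Rightarrow> nat \<Rightarrow> nat \<Rightarrow> nat \<Rightarrow> nat \<Rightarrow> nat \<Rightarrow> nat \<Rightarrow> nat \<Rightarrow> bool" where
  "hat pos F t x y z a b c \<longleftrightarrow> card {t, x, y, z, a, b, c} = 7 \<and>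
    {t, x, y} \<in> F \<and> {t, y, z} \<in> F \<and> {t, z, x} \<in> F \<and>
    {a, y, z} \<in> F \<and> {b, z, x} \<in> F \<and> {c, x, y} \<in> F \<and>
    {x, b, c} \<in> F \<and> {y, c, a} \<in> F \<and> {z, a, b} \<in> F \<and>
    (dist (pos t) (pos x))\<^sup>2 = 97 \<and> (dist (pos t) (pos y))\<^sup>2 = 97 \<and> (dist (pos t) (pos z))\<^sup>2 = 97 \<and>
    (dist (pos x) (pos y))\<^sup>2 = 2 \<and> (dist (pos y) (pos z))\<^sup>2 = 2 \<and> (dist (pos z) (pos x))\<^sup>2 = 2 \<and>
    (dist (pos x) (pos b))\<^sup>2 = 17 \<and> (dist (pos x) (pos c))\<^sup>2 = 17 \<and> (dist (pos y) (pos c))\<^sup>2 = 17 \<and>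
    (dist (pos y) (pos a))\<^sup>2 = 17 \<and> (dist (pos z) (pos a))\<^sup>2 = 17 \<and> (dist (pos z) (pos b))\<^sup>2 = 17 \<and>
    (dist (pos a) (pos b))\<^sup>2 = 32 \<and> (dist (pos b) (pos c))\<^sup>2 = 32 \<and> (dist (pos c) (pos a))\<^sup>2 = 32"

text \<open>Rotation and swap generate all six symmetries of a hat, so each obstruction is proved
  for one labelling only.\<close>

lemma hat_rotate: "hat pos F t x y z a b c \<Longrightarrow> hat pos F t y z x b c a"
  unfolding hat_def by (simp add: insert_commute dist_commute)

lemma hat_swap: "hat pos F t x y z a b c \<Longrightarrow> hat pos F t y x z b a c"
  unfolding hat_def by (simp add: insert_commute dist_commute)

lemma hat_distinct: "hat pos F t x y z a b c \<Longrightarrow> distinct [t, x, y, z, a, b, c]"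
  using card_distinct[of "[t, x, y, z, a, b, c]"] by (simp add: hat_def)

text \<open>Cramer's rule as a linear dependence of any three planar vectors, applied in
  \<open>tip_degree\<close> to the three spike edges.\<close>

lemma coplanar_vectors:
  fixes u v w :: complex
  shows "of_real (Im (cnj v * w)) * u + of_real (Im (cnj w * u)) * v + of_real (Im (cnj u * v)) * w = 0"
  by (simp add: complex_eq_iff algebra_simps)

context net
begin

text \<open>\<open>r\<close> selects the spoke at which the fan is opened; the index
  \<open>Suc i + r\<close> with \<open>i < 4\<close> runs over the other four. Since any one spoke
  may be left out, the five instances together give two cuts, by \<open>degree_two\<close>.\<close>

lemma inner_degree:
  assumes hat: "hat pos F t x y z a b c" and r: "r < 5"
  shows "\<exists>i<4. {x, [c, y, t, z, b] ! ((Suc i + r) mod 5)} \<in> C"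
proof (rule ccontr)
  assume neg: "\<not> ?thesis"
  define L K where "L = [c, y, t, z, b]" and "K = [17, 2, 97, 2, 17 :: real]"
  let ?n = "\<lambda>i. L ! ((i + r) mod 5)" and ?N = "\<lambda>i. K ! ((i + r) mod 5)"
  have lt5: "k < 5 \<Longrightarrow> k = 0 \<or> k = 1 \<or> k = 2 \<or> k = 3 \<or> k = (4::nat)" for k by auto
  note h = hat[unfolded hat_def]
  note d = hat_distinct[OF hat]
  have L: "L ! 0 = c" "L ! 1 = y" "L ! 2 = t" "L ! 3 = z" "L ! 4 = b"
    and K': "K ! 0 = 17" "K ! 1 = 2" "K ! 2 = 97" "K ! 3 = 2" "K ! 4 = 17"
    by (simp_all add: L_def K_def)
  have md: "Suc 0 mod 5 = 1" "Suc 1 mod 5 = 2" "Suc 2 mod 5 = 3" "Suc 3 mod 5 = 4" "Suc 4 mod 5 = 0"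
    "Suc (Suc 0) mod 5 = 2" "Suc (Suc 1) mod 5 = 3" "Suc (Suc 2) mod 5 = 4" "Suc (Suc 3) mod 5 = 0"
    "Suc (Suc 4) mod 5 = 1"
    by simp_all
  note eqs = L K' md
  have F: "{x, L ! k, L ! (Suc k mod 5)} \<in> F" if "k < 5" for k
    using lt5[OF that] h by (elim disjE; simp only: eqs insert_commute)
  have base: "(dist (pos (L ! k)) (pos (L ! (Suc k mod 5))))\<^sup>2 = K ! k + K ! (Suc k mod 5) - 2"
    if "k < 5" for k
    using lt5[OF that] h by (elim disjE; simp only: eqs dist_commute; simp)
  have len: "(dist (pos x) (pos (L ! k)))\<^sup>2 = K ! k" if "k < 5" for k
    using lt5[OF that] h by (elim disjE; simp only: eqs dist_commute; simp)
  have K: "K ! k > 0" if "k < 5" for k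
    using lt5[OF that] by (elim disjE; simp only: eqs; simp)
  have ne: "L ! k \<noteq> L ! (Suc (Suc k) mod 5)" if "k < 5" for k
    using lt5[OF that] d by (elim disjE; simp only: eqs; force)
  show False
  proof (rule negative_curvature[of x ?n ?N])
    show "{x, ?n i, ?n (Suc i)} \<in> F" for i
      using F[of "(i + r) mod 5"] by (simp add: mod_Suc_eq)
    show "{x, ?n (Suc i)} \<notin> C" if "Suc i < 5" for i using neg that by (simp add: L_def)
    show "?n 5 = ?n 0" by simp
    show "?n i \<noteq> ?n (Suc (Suc i))" for i using ne[of "(i + r) mod 5"] by (simp add: mod_Suc_Suc_eq)
    show "?n 4 \<noteq> ?n 1"
      using lt5[OF r] d by (elim disjE; force simp: L_def)
    show "(dist (pos x) (pos (?n i)))\<^sup>2 = ?N i" for i using len by simp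
    show "(dist (pos (?n i)) (pos (?n (Suc i))))\<^sup>2 = ?N i + ?N (Suc i) - 2" for i
      using base[of "(i + r) mod 5"] by (simp add: mod_Suc_eq)
    show "?N i > 0" for i using K by simp
  next
    let ?s = "\<lambda>i. Complex 1 (sqrt (?N i * ?N (Suc i) - 1))"
    show "?s i = Complex 1 (sqrt (?N i * ?N (Suc i) - 1))" for i ..
    \<comment> \<open>The lengths in \<open>K\<close> are palindromic, so the five ways of leaving
      out one sector give only the three products of \<open>fan_products\<close>.\<close>
    show "Im (?s 0 * ?s 1 * ?s 2 * ?s 3) < 0" "Im (?s 0 * ?s 1 * ?s 2 * ?s 3 * ?s 4) > 0"
      using lt5[OF r] fan_products unfolding K_def
      by (elim disjE; simp del: times_complex.sel add: ac_simps)+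
  qed
qed

text \<open>With no cut at the tip, the three spike edges would keep their Gram matrix in the plane:
  97 on the diagonal and 96 off it. That matrix is regular, but three planar vectors are
  dependent.\<close>

lemma tip_degree:
  assumes hat: "hat pos F t x y z a b c"
  shows "{t, x} \<in> C \<or> {t, y} \<in> C \<or> {t, z} \<in> C"
proof (rule ccontr)
  assume neg: "\<not> ?thesis"
  note h = hat[unfolded hat_def]
  note d = hat_distinct[OF hat]
  let ?f = "{t, x, y}" and ?g = "{t, y, z}" and ?h = "{t, z, x}"
  have fgh: "?f \<in> F" "?g \<in> F" "?h \<in> F" using h by auto
  have "?f \<inter> ?g = {t, y}" "?g \<inter> ?h = {t, z}" "?f \<inter> ?h = {t, x}" using d by auto
  moreover have "?f \<noteq> ?g" "?g \<noteq> ?h" "?f \<noteq> ?h" using d by auto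
  ultimately have adj: "uncut_adj F C ?f ?g" "uncut_adj F C ?g ?h" "uncut_adj F C ?f ?h"
    unfolding uncut_adj_def using neg d fgh by auto
  define T X Y Z where "T = img ?f t" "X = img ?f x - T" "Y = img ?f y - T" "Z = img ?g z - T"
  note def = this
  have T: "img ?g t = T" "img ?h t = T" "img ?g y - T = Y" "img ?h z - T = Z" "img ?h x - T = X"
    unfolding def using img_agree[OF adj(1), of t] img_agree[OF adj(1), of y] img_agree[OF adj(2), of t]
      img_agree[OF adj(2), of z] img_agree[OF adj(3), of x] by auto
  have XY: "Re (cnj X * Y) = 96" and YZ: "Re (cnj Y * Z) = 96" and ZX: "Re (cnj Z * X) = 96"
    using img_dot[OF fgh(1), of t x y] img_dot[OF fgh(2), of t y z] img_dot[OF fgh(3), of t z x] h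
    unfolding def(1)[symmetric] T def(2-4)[symmetric] by simp_all
  have n: "(cmod X)\<^sup>2 = 97" "(cmod Y)\<^sup>2 = 97" "(cmod Z)\<^sup>2 = 97"
    using dist_img[OF fgh(1), of x t] dist_img[OF fgh(1), of y t] dist_img[OF fgh(2), of z t] h
    unfolding def T by (simp_all add: dist_commute)
  define p q r where "p = Im (cnj Y * Z)" "q = Im (cnj Z * X)" "r = Im (cnj X * Y)"
  note pqr = this
  have 0: "of_real p * X + of_real q * Y + of_real r * Z = 0"
    unfolding pqr by (rule coplanar_vectors)
  have dot: "p * Re (cnj V * X) + q * Re (cnj V * Y) + r * Re (cnj V * Z) = 0" for V
    using arg_cong[OF 0, of "\<lambda>u. Re (cnj V * u)"] by (simp add: algebra_simps)
  have sw: "Re (cnj u * v) = Re (cnj v * u)" "Re (cnj u * u) = (cmod u)\<^sup>2" for u v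
    unfolding cmod_power2 by (simp_all add: power2_eq_square)
  have "97 * p + 96 * q + 96 * r = 0" "96 * p + 97 * q + 96 * r = 0" "96 * p + 96 * q + 97 * r = 0"
    using dot[of X] dot[of Y] dot[of Z] XY YZ ZX sw(1)[of X Z] sw(1)[of Y X] sw(1)[of Z Y]
    unfolding sw(2) n by (simp_all only: mult.commute)
  then have "r = 0" by linarith
  then show False using Im_cnj_mult_sq[of X Y] unfolding pqr[symmetric] n XY by simp
qed

text \<open>Excludes the path of cuts from \<open>t\<close> through \<open>z\<close>,
  \<open>y\<close>, \<open>x\<close> to a corner. With the five listed edges uncut, the faces around
  \<open>z\<close> and then \<open>y\<close> unfold rigidly, and the edge from \<open>z\<close> to
  \<open>t\<close> in face \<open>{z, x, t}\<close> crosses the edge from \<open>y\<close> to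
  \<open>x\<close> in face \<open>{y, c, x}\<close>.\<close>

lemma spike_overlap:
  assumes hat: "hat pos F t x y z a b c"
  shows "{z, x} \<in> C \<or> {z, b} \<in> C \<or> {z, a} \<in> C \<or> {y, a} \<in> C \<or> {y, c} \<in> C"
proof (rule ccontr)
  assume neg: "\<not> ?thesis"
  note h = hat[unfolded hat_def]
  note d = hat_distinct[OF hat]
  have lt: "k < 4 \<Longrightarrow> k = 0 \<or> k = 1 \<or> k = 2 \<or> k = (3::nat)"
    "k \<le> 4 \<Longrightarrow> k = 0 \<or> k = 1 \<or> k = 2 \<or> k = 3 \<or> k = (4::nat)"
    "Suc k < 4 \<Longrightarrow> k = 0 \<or> k = 1 \<or> k = (2::nat)"
    "k < 3 \<Longrightarrow> k = 0 \<or> k = 1 \<or> k = (2::nat)"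
    "k \<le> 3 \<Longrightarrow> k = 0 \<or> k = 1 \<or> k = 2 \<or> k = (3::nat)"
    "Suc k < 3 \<Longrightarrow> k = 0 \<or> k = (1::nat)" for k by auto
  define L K where "L = (!) [t, x, b, a, y]" and "K = (!) [97, 2, 17, 17, 2 :: real]"
  define L' K' where "L' = (!) [z, a, c, x]" and "K' = (!) [2, 17, 17, 2 :: real]"
  note defs = L_def K_def L'_def K'_def
  \<comment> \<open>The fan at \<open>z\<close> runs from \<open>t\<close> over \<open>x\<close>,
    \<open>b\<close>, \<open>a\<close> to \<open>y\<close>; the fan at \<open>y\<close> runs from
    \<open>z\<close> over \<open>a\<close>, \<open>c\<close> to \<open>x\<close>. They are joined at
    the face \<open>{y, z, a}\<close>.\<close>
  have "\<exists>e. fan_layout 4 z L K e"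
  proof (rule fan[of 4 z L K])
    show "{z, L i, L (Suc i)} \<in> F" if "i < 4" for i
      using lt(1)[OF that] h unfolding defs by (elim disjE; simp add: insert_commute numeral_eq_Suc)
    show "{z, L (Suc i)} \<notin> C" if "Suc i < 4" for i
      using lt(3)[OF that] neg unfolding defs by (elim disjE; simp add: numeral_eq_Suc)
    show "L i \<noteq> L (Suc (Suc i))" if "Suc i < 4" for i
      using lt(3)[OF that] d unfolding defs by (elim disjE; force simp: numeral_eq_Suc)
    show "(dist (pos z) (pos (L i)))\<^sup>2 = K i" if "i \<le> 4" for i
      using lt(2)[OF that] h unfolding defs by (elim disjE; simp add: dist_commute numeral_eq_Suc)
    show "(dist (pos (L i)) (pos (L (Suc i))))\<^sup>2 = K i + K (Suc i) - 2" if "i < 4" for i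
      using lt(1)[OF that] h unfolding defs by (elim disjE; simp add: dist_commute numeral_eq_Suc)
  qed simp
  then obtain e where e0: "fan_layout 4 z L K e" by blast
  then have e: "\<And>i. i < 4 \<Longrightarrow> img {z, L i, L (Suc i)} z = img {z, L 0, L (Suc 0)} z"
    "\<And>i. i < 4 \<Longrightarrow> img {z, L i, L (Suc i)} (L i) = img {z, L 0, L (Suc 0)} z + e i"
    "\<And>i. i < 4 \<Longrightarrow> img {z, L i, L (Suc i)} (L (Suc i)) = img {z, L 0, L (Suc 0)} z + e (Suc i)"
    "\<And>i. i \<le> 4 \<Longrightarrow> (cmod (e i))\<^sup>2 = K i"
    "\<And>i. i < 4 \<Longrightarrow> Re (cnj (e i) * e (Suc i)) = 1"
    "\<And>i. Suc i < 4 \<Longrightarrow>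
      Im (cnj (e i) * e (Suc i)) * Im (cnj (e (Suc i)) * e (Suc (Suc i))) > 0"
    unfolding fan_layout_def by blast+
  have "\<exists>g. fan_layout 3 y L' K' g"
  proof (rule fan[of 3 y L' K'])
    show "{y, L' i, L' (Suc i)} \<in> F" if "i < 3" for i
      using lt(4)[OF that] h unfolding defs by (elim disjE; simp add: insert_commute numeral_eq_Suc)
    show "{y, L' (Suc i)} \<notin> C" if "Suc i < 3" for i
      using lt(6)[OF that] neg unfolding defs by (elim disjE; simp add: numeral_eq_Suc)
    show "L' i \<noteq> L' (Suc (Suc i))" if "Suc i < 3" for i
      using lt(6)[OF that] d unfolding defs by (elim disjE; force simp: numeral_eq_Suc)
    show "(dist (pos y) (pos (L' i)))\<^sup>2 = K' i" if "i \<le> 3" for i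
      using lt(5)[OF that] h unfolding defs by (elim disjE; simp add: dist_commute numeral_eq_Suc)
    show "(dist (pos (L' i)) (pos (L' (Suc i))))\<^sup>2 = K' i + K' (Suc i) - 2" if "i < 3" for i
      using lt(4)[OF that] h unfolding defs by (elim disjE; simp add: dist_commute numeral_eq_Suc)
  qed simp
  then obtain g where g0: "fan_layout 3 y L' K' g" by blast
  then have g: "\<And>i. i < 3 \<Longrightarrow> img {y, L' i, L' (Suc i)} y = img {y, L' 0, L' (Suc 0)} y"
    "\<And>i. i < 3 \<Longrightarrow> img {y, L' i, L' (Suc i)} (L' i) = img {y, L' 0, L' (Suc 0)} y + g i"
    "\<And>i. i < 3 \<Longrightarrow> img {y, L' i, L' (Suc i)} (L' (Suc i)) = img {y, L' 0, L' (Suc 0)} y + g (Suc i)"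
    "\<And>i. i \<le> 3 \<Longrightarrow> (cmod (g i))\<^sup>2 = K' i"
    "\<And>i. i < 3 \<Longrightarrow> Re (cnj (g i) * g (Suc i)) = 1"
    "\<And>i. Suc i < 3 \<Longrightarrow>
      Im (cnj (g i) * g (Suc i)) * Im (cnj (g (Suc i)) * g (Suc (Suc i))) > 0"
    unfolding fan_layout_def by blast+
  define O' where "O' = img {z, t, x} z"
  have f3: "{z, a, y} = {y, z, a}" by auto
  have ev: "img {y, z, a} z = O'" "img {y, z, a} a = O' + e 3" "img {y, z, a} y = O' + e 4"
    "img {z, t, x} t = O' + e 0"
    using e(1)[of 3] e(2)[of 3] e(3)[of 3] e(2)[of 0]
    unfolding defs O'_def by (simp_all add: numeral_eq_Suc f3)
  have gv: "img {y, z, a} z = img {y, z, a} y + g 0" "img {y, z, a} a = img {y, z, a} y + g 1"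
    "img {y, c, x} y = img {y, z, a} y" "img {y, c, x} x = img {y, z, a} y + g 3"
    using g(2)[of 0] g(3)[of 0] g(1)[of 2] g(3)[of 2]
    unfolding defs by (simp_all add: numeral_eq_Suc)
  have "\<exists>l r. 0 < l \<and> l < 1 \<and> 0 < r \<and> r < 1 \<and> e 4 + of_real l * g 3 = of_real r * e 0"
  proof (rule two_fan_crossing)
    show "g 0 = - e 4" "g 1 = e 3 - e 4" using gv(1,2) ev(1-3) by (simp_all add: algebra_simps eq_neg_iff_add_eq_0)
    show "(cmod (e 0))\<^sup>2 = 97" "(cmod (e 1))\<^sup>2 = 2" "(cmod (e 2))\<^sup>2 = 17"
      "(cmod (e 3))\<^sup>2 = 17" "(cmod (e 4))\<^sup>2 = 2"
      using e(4)[of 0] e(4)[of 1] e(4)[of 2] e(4)[of 3] e(4)[of 4] unfolding defs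
      by (simp_all add: numeral_eq_Suc)
    show "(cmod (g 1))\<^sup>2 = 17" "(cmod (g 2))\<^sup>2 = 17" "(cmod (g 3))\<^sup>2 = 2"
      using g(4)[of 1] g(4)[of 2] g(4)[of 3] unfolding defs by (simp_all add: numeral_eq_Suc)
  qed (use e(5,6) g(5,6) in auto)
  then obtain l r where lr: "0 < l" "l < 1" "0 < r" "r < 1"
    "e 4 + of_real l * g 3 = of_real r * e 0" by blast
  have F: "{z, x, t} \<in> F" "{y, c, x} \<in> F" using h by (simp_all add: insert_commute)
  have f0: "{z, t, x} = {z, x, t}" by auto
  have t: "t \<notin> {y, c, x}" using d by auto
  have "r = 0"
  proof (rule overlap_coefficient_zero[OF F t])
    show "0 \<le> 1 - r" "0 \<le> (0::real)" "0 \<le> r" "1 - r + 0 + r = 1" using lr by auto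
    show "0 \<le> 1 - l" "0 \<le> (0::real)" "0 \<le> l" "1 - l + 0 + l = 1" using lr by auto
    have "O' + of_real r * e 0 = O' + (e 4 + of_real l * g 3)" unfolding lr(5) ..
    then show "of_real (1 - r) * img {z, x, t} z + of_real 0 * img {z, x, t} x + of_real r * img {z, x, t} t =
      of_real (1 - l) * img {y, c, x} y + of_real 0 * img {y, c, x} c + of_real l * img {y, c, x} x"
      using ev gv unfolding f0 O'_def by (simp add: algebra_simps)
  qed
  then show False using lr by simp
qed

end

subsection \<open>Counting cuts in a hat\<close>

text \<open>The degrees sum to at least 1 + 2 + 2 + 2 = 7, so there are at least four cuts, and if
  exactly four, at most one goes to a corner. If none does, the cuts contain the ring or form a
  4-cycle through the tip, and both are excluded. If one does, all degrees are minimal and the cuts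
  form a path from the tip through the three inner vertices to a corner; the last six inequalities
  exclude the six orders.\<close>

lemma five_cuts:
  fixes tx ty tz xy yz zx xb xc yc ya za zb :: nat
  assumes le: "tx \<le> 1" "ty \<le> 1" "tz \<le> 1" "xy \<le> 1" "yz \<le> 1" "zx \<le> 1"
    and "tx + ty + tz \<ge> 1"
    and "xc + xy + tx + zx + xb \<ge> 2" "ya + yz + ty + xy + yc \<ge> 2" "zb + zx + tz + yz + za \<ge> 2"
    and "xy + yz + zx \<le> 2"
    and "tx + tz + xy + yz \<le> 3" "ty + tx + yz + zx \<le> 3" "tz + ty + zx + xy \<le> 3"
    and "zx + zb + za + ya + yc \<ge> 1" "xy + xc + xb + zb + za \<ge> 1" "yz + ya + yc + xc + xb \<ge> 1"
      "yz + za + zb + xb + xc \<ge> 1" "zx + xb + xc + yc + ya \<ge> 1" "xy + yc + ya + za + zb \<ge> 1"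
  shows "tx + ty + tz + xy + yz + zx + xb + xc + yc + ya + za + zb \<ge> 5"
proof -
  have "xy = 0 \<or> xy = 1" "yz = 0 \<or> yz = 1" "zx = 0 \<or> zx = 1"
    "tx = 0 \<or> tx = 1" "ty = 0 \<or> ty = 1" "tz = 0 \<or> tz = 1"
    using le by auto
  then show ?thesis
    using assms(7-) by (elim disjE; simp only:; linarith)
qed
lemma degree_two:
  assumes "(b \<or> c \<or> d \<or> e) \<and> (a \<or> c \<or> d \<or> e) \<and> (a \<or> b \<or> d \<or> e) \<and> (a \<or> b \<or> c \<or> e) \<and> (a \<or> b \<or> c \<or> d)"
  shows "of_bool a + of_bool b + of_bool c + of_bool d + of_bool e \<ge> (2::nat)"
  using assms by (cases a; cases b; cases c; cases d; cases e; simp)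

lemma ex_less_4: "(\<exists>i<4. P i) \<longleftrightarrow> P 0 \<or> P 1 \<or> P 2 \<or> P (3::nat)"
  by (auto simp: numeral_eq_Suc less_Suc_eq)

lemma two_subset_of_triple:
  assumes "S \<subseteq> {a, b, c}" "card S = 2"
  shows "S = {a, b} \<or> S = {b, c} \<or> S = {c, a}"
proof -
  obtain u v where "S = {u, v}" "u \<noteq> v" using assms(2) by (auto simp: card_2_iff)
  then show ?thesis using assms(1) by auto
qed

text \<open>A spanning tree of the faces is grown from \<open>f0\<close>: each new face brings the
  uncut edge by which it is reached. The edge is new because each edge used before already has two
  faces in \<open>R\<close>, and the face outside \<open>R\<close> would be a third.\<close>

lemma connected_many_edges:
  assumes "finite F" "f0 \<in> F"
    and conn: "\<And>g. g \<in> F \<Longrightarrow> (uncut_adj F C)\<^sup>*\<^sup>* f0 g"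
    and two: "\<And>e. e \<in> edges F \<Longrightarrow> card {f \<in> F. e \<subseteq> f} = 2"
    and fin: "finite (edges F)"
  shows "card F \<le> card (edges F - C) + 1"
proof -
  have adj_edge: "f \<inter> g \<in> edges F - C" if "uncut_adj F C f g" for f g
    using that unfolding uncut_adj_def edges_def by auto
  have "k < card F \<Longrightarrow> \<exists>R E. R \<subseteq> F \<and> f0 \<in> R \<and> card R = Suc k \<and> E \<subseteq> edges F - C \<and> card E = k \<and>
      (\<forall>e\<in>E. \<exists>f\<in>R. \<exists>g\<in>R. f \<noteq> g \<and> e \<subseteq> f \<and> e \<subseteq> g)" for k
  proof (induction k)
    case 0
    show ?case using assms(2) by (intro exI[of _ "{f0}"] exI[of _ "{}"]) auto
  next
    case (Suc k)
    then obtain R E where RE: "R \<subseteq> F" "f0 \<in> R" "card R = Suc k" "E \<subseteq> edges F - C" "card E = k"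
      "\<And>e. e \<in> E \<Longrightarrow> \<exists>f\<in>R. \<exists>g\<in>R. f \<noteq> g \<and> e \<subseteq> f \<and> e \<subseteq> g" by auto
    have finR: "finite R" and finE: "finite E"
      using RE(1,4) assms(1) fin by (auto intro: finite_subset)
    have "R \<noteq> F" using RE(3) Suc.prems by auto
    then obtain h where h: "h \<in> F" "h \<notin> R" using RE(1) by blast
    have "\<exists>f g. f \<in> R \<and> g \<notin> R \<and> uncut_adj F C f g"
    proof (rule ccontr)
      assume no: "\<not> ?thesis"
      have "(uncut_adj F C)\<^sup>*\<^sup>* f0 g \<Longrightarrow> g \<in> R" for g
        by (induction rule: rtranclp_induct) (use no RE(2) in auto)
      then show False using conn h by blast
    qed
    then obtain f g where fg: "f \<in> R" "g \<notin> R" "uncut_adj F C f g" by blast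
    have mem: "f \<in> F" "g \<in> F" "f \<noteq> g" using fg by (auto simp: uncut_adj_def)
    have new: "f \<inter> g \<notin> E"
    proof
      assume "f \<inter> g \<in> E"
      then obtain f' g' where fg': "f' \<in> R" "g' \<in> R" "f' \<noteq> g'" "f \<inter> g \<subseteq> f'" "f \<inter> g \<subseteq> g'"
        using RE(6)[OF \<open>f \<inter> g \<in> E\<close>] by (elim bexE conjE) (rule that)
      have "{f', g', g} \<subseteq> {h \<in> F. f \<inter> g \<subseteq> h}" using fg' mem RE(1) by auto
      then have "card {f', g', g} \<le> card {h \<in> F. f \<inter> g \<subseteq> h}"
        by (intro card_mono) (use assms(1) in auto)
      moreover have "card {f', g', g} = 3" using fg' fg(2) by (auto simp: card_insert_if)
      moreover have "card {h \<in> F. f \<inter> g \<subseteq> h} = 2" using two adj_edge[OF fg(3)] by auto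
      ultimately show False by simp
    qed
    show ?case
    proof (rule exI[of _ "insert g R"], rule exI[of _ "insert (f \<inter> g) E"], intro conjI)
      show "insert (f \<inter> g) E \<subseteq> edges F - C" using RE(4) adj_edge[OF fg(3)] by auto
      show "\<forall>e\<in>insert (f \<inter> g) E. \<exists>f\<in>insert g R. \<exists>g\<in>insert g R. f \<noteq> g \<and> e \<subseteq> f \<and> e \<subseteq> g"
      proof
        fix e assume e: "e \<in> insert (f \<inter> g) E"
        show "\<exists>f\<in>insert g R. \<exists>g\<in>insert g R. f \<noteq> g \<and> e \<subseteq> f \<and> e \<subseteq> g"
        proof (cases "e \<in> E")
          case True
          from RE(6)[OF this] obtain f' g' where "f' \<in> R" "g' \<in> R" "f' \<noteq> g'" "e \<subseteq> f'" "e \<subseteq> g'"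
            by (elim bexE conjE) (rule that)
          then show ?thesis by (intro bexI[of _ f'] bexI[of _ g']) simp_all
        next
          case False
          then have ef: "e \<subseteq> f" and eg: "e \<subseteq> g" using e by simp_all
          show ?thesis
            by (rule bexI[of _ f], rule bexI[of _ g]) (use mem(3) ef eg fg(1) in simp_all)
        qed
      qed
    qed (use RE fg mem new finR finE in auto)
  qed
  moreover have "card F > 0" using assms(1,2) card_gt_0_iff by blast
  ultimately obtain E where "E \<subseteq> edges F - C" "card E = card F - 1"
    by (metis diff_less zero_less_one)
  then have "card F - 1 \<le> card (edges F - C)" using card_mono[of "edges F - C" E] fin by auto
  then show ?thesis by simp
qed

definition hat_edges :: "nat \<Rightarrow> nat \<Rightarrow> nat \<Rightarrow> nat \<Rightarrow> nat \<Rightarrow> nat \<Rightarrow> nat \<Rightarrow> nat set list" where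
  "hat_edges t x y z a b c = [{t, x}, {t, y}, {t, z}, {x, y}, {y, z}, {z, x},
    {x, b}, {x, c}, {y, c}, {y, a}, {z, a}, {z, b}]"

section \<open>Cuts that would detach part of a spike\<close>

locale one_piece_net = net +
  assumes connected: "\<And>f g. f \<in> F \<Longrightarrow> g \<in> F \<Longrightarrow> (uncut_adj F C)\<^sup>*\<^sup>* f g"
    and two_faces: "\<And>e. e \<in> edges F \<Longrightarrow> card {f \<in> F. e \<subseteq> f} = 2"
begin

lemma leaves:
  assumes "G \<subseteq> F" "f \<in> G" "h \<in> F - G"
  obtains g g' where "g \<in> G" "g' \<in> F - G" "uncut_adj F C g g'"
proof (rule ccontr)
  assume no: "\<not> thesis"
  have "(uncut_adj F C)\<^sup>*\<^sup>* f g \<Longrightarrow> g \<in> G" for g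
    by (induction rule: rtranclp_induct) (use no that assms(2) in \<open>auto simp: uncut_adj_def\<close>)
  then show False using connected[of f h] assms by blast
qed

lemma third_face:
  assumes "f \<in> F" "g \<in> F" "h \<in> F" "f \<noteq> g" "card e = 2" "e \<subseteq> f" "e \<subseteq> g" "e \<subseteq> h"
  shows "h = f \<or> h = g"
proof (rule ccontr)
  assume "\<not> ?thesis"
  then have "card {f, g, h} = 3" using assms(4) by (simp add: card_insert_if) blast
  moreover have "card {k \<in> F. e \<subseteq> k} = 2" using assms two_faces[of e] by (auto simp: edges_def)
  moreover have "finite {k \<in> F. e \<subseteq> k}" using calculation(2) by (intro card_ge_0_finite) simp
  then have "card {f, g, h} \<le> card {k \<in> F. e \<subseteq> k}"
    using assms by (intro card_mono) simp_all
  ultimately show False by simp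
qed

text \<open>The whole spike would fall off: its three faces adjoin the rest only along the
  ring.\<close>

lemma ring_not_cut:
  assumes hat: "hat pos F t x y z a b c"
  shows "\<not> ({x, y} \<in> C \<and> {y, z} \<in> C \<and> {z, x} \<in> C)"
proof
  assume cut: "{x, y} \<in> C \<and> {y, z} \<in> C \<and> {z, x} \<in> C"
  note h = hat[unfolded hat_def]
  note d = hat_distinct[OF hat]
  let ?G = "{{t, x, y}, {t, y, z}, {t, z, x}}"
  have F: "{t, x, y} \<in> F" "{t, y, z} \<in> F" "{t, z, x} \<in> F" using h by auto
  have ne: "{t, x, y} \<noteq> {t, y, z}" "{t, y, z} \<noteq> {t, z, x}" "{t, z, x} \<noteq> {t, x, y}" using d by auto
  have "t \<notin> {a, y, z}" using d by auto
  then have "{a, y, z} \<in> F - ?G" using h by auto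
  then obtain g g' where g: "g \<in> ?G" "g' \<in> F - ?G" "uncut_adj F C g g'"
    using leaves[of ?G "{t, x, y}"] F by blast
  have e: "card (g \<inter> g') = 2" "g \<inter> g' \<notin> C" using g(3) by (auto simp: uncut_adj_def)
  obtain I where I: "I = g \<inter> g'" by blast
  have I2: "card I = 2" "I \<notin> C" "I \<subseteq> g" "I \<subseteq> g'" using e I by auto
  have "I = {x, t} \<or> I = {y, t} \<or> I = {z, t}"
  proof -
    consider "g = {t, x, y}" | "g = {t, y, z}" | "g = {t, z, x}" using g(1) by blast
    then show ?thesis
    proof cases
      case 1
    then have "I \<subseteq> {t, x, y}" using I2(3) by simp
    from two_subset_of_triple[OF this I2(1)] show ?thesis
      using I2(2) cut by (elim disjE) (simp_all add: insert_commute)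
    next
    case 2
    then have "I \<subseteq> {t, y, z}" using I2(3) by simp
    from two_subset_of_triple[OF this I2(1)] show ?thesis
      using I2(2) cut by (elim disjE) (simp_all add: insert_commute)
    next
    case 3
    then have "I \<subseteq> {t, z, x}" using I2(3) by simp
    from two_subset_of_triple[OF this I2(1)] show ?thesis
      using I2(2) cut by (elim disjE) (simp_all add: insert_commute)
    qed
  qed
  then have "{t, x} \<subseteq> g' \<or> {t, y} \<subseteq> g' \<or> {t, z} \<subseteq> g'" using I2(4) by blast
  then consider "{t, x} \<subseteq> g'" | "{t, y} \<subseteq> g'" | "{t, z} \<subseteq> g'" by blast
  then have "g' \<in> ?G"
  proof cases
    case 1
    have "g' = {t, z, x} \<or> g' = {t, x, y}"
      by (rule third_face[OF F(3,1) _ ne(3) _ _ _ 1]) (use d g(2) in auto)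
    then show ?thesis by blast
  next
    case 2
    have "g' = {t, x, y} \<or> g' = {t, y, z}"
      by (rule third_face[OF F(1,2) _ ne(1) _ _ _ 2]) (use d g(2) in auto)
    then show ?thesis by blast
  next
    case 3
    have "g' = {t, y, z} \<or> g' = {t, z, x}"
      by (rule third_face[OF F(2,3) _ ne(2) _ _ _ 3]) (use d g(2) in auto)
    then show ?thesis by blast
  qed
  then show False using g(2) by blast
qed

text \<open>The pair \<open>{t, x, y}\<close>, \<open>{t, y, z}\<close> would fall off, since the
  four cut edges are its entire boundary.\<close>

lemma spike_pair_not_cut:
  assumes hat: "hat pos F t x y z a b c"
  shows "\<not> ({t, x} \<in> C \<and> {t, z} \<in> C \<and> {x, y} \<in> C \<and> {y, z} \<in> C)"
proof
  assume cut: "{t, x} \<in> C \<and> {t, z} \<in> C \<and> {x, y} \<in> C \<and> {y, z} \<in> C"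
  note h = hat[unfolded hat_def]
  note d = hat_distinct[OF hat]
  let ?G = "{{t, x, y}, {t, y, z}}"
  have F: "{t, x, y} \<in> F" "{t, y, z} \<in> F" using h by auto
  have ne: "{t, x, y} \<noteq> {t, y, z}" using d by auto
  have "t \<notin> {a, y, z}" using d by auto
  then have "{a, y, z} \<in> F - ?G" using h by auto
  then obtain g g' where g: "g \<in> ?G" "g' \<in> F - ?G" "uncut_adj F C g g'"
    using leaves[of ?G "{t, x, y}"] F by blast
  have e: "card (g \<inter> g') = 2" "g \<inter> g' \<notin> C" using g(3) by (auto simp: uncut_adj_def)
  obtain I where I: "I = g \<inter> g'" by blast
  have I2: "card I = 2" "I \<notin> C" "I \<subseteq> g" "I \<subseteq> g'" using e I by auto
  have "I = {t, y}"
  proof -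
    consider "g = {t, x, y}" | "g = {t, y, z}" using g(1) by blast
    then show ?thesis
    proof cases
      case 1
    then have "I \<subseteq> {t, x, y}" using I2(3) by simp
    from two_subset_of_triple[OF this I2(1)] show ?thesis
      using I2(2) cut by (elim disjE) (simp_all add: insert_commute)
    next
    case 2
    then have "I \<subseteq> {t, y, z}" using I2(3) by simp
    from two_subset_of_triple[OF this I2(1)] show ?thesis
      using I2(2) cut by (elim disjE) (simp_all add: insert_commute)
    qed
  qed
  then have "{t, y} \<subseteq> g'" using I2(4) by blast
  have "g' = {t, x, y} \<or> g' = {t, y, z}"
    by (rule third_face[OF F _ ne _ _ _ \<open>{t, y} \<subseteq> g'\<close>]) (use d g(2) in auto)
  then have "g' \<in> ?G" by blast
  then show False using g(2) by blast
qed

definition cut :: "nat set \<Rightarrow> nat" where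
  "cut e = of_bool (e \<in> C)"

lemma inner_degree_sum:
  assumes hat: "hat pos F t x y z a b c"
  shows "cut {x, c} + cut {x, y} + cut {t, x} + cut {z, x} + cut {x, b} \<ge> 2"
  unfolding cut_def
  by (rule degree_two)
    (use inner_degree[OF hat, of 0] inner_degree[OF hat, of 1] inner_degree[OF hat, of 2]
      inner_degree[OF hat, of 3] inner_degree[OF hat, of 4] in
      \<open>simp add: ex_less_4 insert_commute; blast\<close>)

lemma hat_five_cuts:
  assumes hat: "hat pos F t x y z a b c"
  shows "card (C \<inter> set (hat_edges t x y z a b c)) \<ge> 5"
proof -
  note d = hat_distinct[OF hat]
  note h2 = hat_rotate[OF hat] and h3 = hat_rotate[OF hat_rotate[OF hat]]
  note s1 = hat_swap[OF hat] and s2 = hat_swap[OF h2] and s3 = hat_swap[OF h3]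
  have dist: "distinct (hat_edges t x y z a b c)"
    using d unfolding hat_edges_def by (auto simp: doubleton_eq_iff)
  have "card (C \<inter> set L) = (\<Sum>e\<leftarrow>L. cut e)" if "distinct L" for L
    using that by (induction L) (auto simp: cut_def Int_insert_right)
  from this[OF dist]
  have "card (C \<inter> set (hat_edges t x y z a b c)) = (\<Sum>e\<leftarrow>hat_edges t x y z a b c. cut e)" .
  also have "\<dots> = cut {t, x} + cut {t, y} + cut {t, z} + cut {x, y} + cut {y, z} + cut {z, x}
    + cut {x, b} + cut {x, c} + cut {y, c} + cut {y, a} + cut {z, a} + cut {z, b}"
    by (simp add: hat_edges_def)
  also have "\<dots> \<ge> 5"
  proof (rule five_cuts)
    show "cut {t, x} + cut {t, y} + cut {t, z} \<ge> 1"
      using tip_degree[OF hat] by (auto simp: cut_def)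
    show "cut {x, c} + cut {x, y} + cut {t, x} + cut {z, x} + cut {x, b} \<ge> 2"
      by (rule inner_degree_sum[OF hat])
    show "cut {y, a} + cut {y, z} + cut {t, y} + cut {x, y} + cut {y, c} \<ge> 2"
      by (rule inner_degree_sum[OF h2])
    show "cut {z, b} + cut {z, x} + cut {t, z} + cut {y, z} + cut {z, a} \<ge> 2"
      by (rule inner_degree_sum[OF h3])
    show "cut {x, y} + cut {y, z} + cut {z, x} \<le> 2"
      using ring_not_cut[OF hat] by (auto simp: cut_def)
    show "cut {t, x} + cut {t, z} + cut {x, y} + cut {y, z} \<le> 3"
      using spike_pair_not_cut[OF hat] by (auto simp: cut_def)
    show "cut {t, y} + cut {t, x} + cut {y, z} + cut {z, x} \<le> 3"
      using spike_pair_not_cut[OF h2] by (auto simp: cut_def)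
    show "cut {t, z} + cut {t, y} + cut {z, x} + cut {x, y} \<le> 3"
      using spike_pair_not_cut[OF h3] by (auto simp: cut_def)
    \<comment> \<open>One instance of \<open>spike_overlap\<close> for each order in which a path
      can visit the inner vertices: three rotations, then three reflections.\<close>
    show "cut {z, x} + cut {z, b} + cut {z, a} + cut {y, a} + cut {y, c} \<ge> 1"
      using spike_overlap[OF hat] by (auto simp: cut_def)
    show "cut {x, y} + cut {x, c} + cut {x, b} + cut {z, b} + cut {z, a} \<ge> 1"
      using spike_overlap[OF h2] by (auto simp: cut_def)
    show "cut {y, z} + cut {y, a} + cut {y, c} + cut {x, c} + cut {x, b} \<ge> 1"
      using spike_overlap[OF h3] by (auto simp: cut_def)
    show "cut {y, z} + cut {z, a} + cut {z, b} + cut {x, b} + cut {x, c} \<ge> 1"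
      using spike_overlap[OF s1] by (auto simp: cut_def insert_commute)
    show "cut {z, x} + cut {x, b} + cut {x, c} + cut {y, c} + cut {y, a} \<ge> 1"
      using spike_overlap[OF s2] by (auto simp: cut_def insert_commute)
    show "cut {x, y} + cut {y, c} + cut {y, a} + cut {z, a} + cut {z, b} \<ge> 1"
      using spike_overlap[OF s3] by (auto simp: cut_def insert_commute)
  qed (simp_all add: cut_def)
  finally show ?thesis .
qed

end

subsection \<open>Complexes that are star-shaped around the origin\<close>

text \<open>A supporting hyperplane cuts out a face of the hull, and a face of the hull of a finite
  set is spanned by some of its points.\<close>

lemma convex_hull_support:
  fixes n q :: "'a::euclidean_space"
  assumes "finite S" and le: "\<And>x. x \<in> S \<Longrightarrow> n \<bullet> x \<le> 0" and q: "q \<in> convex hull S" "n \<bullet> q = 0"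
  shows "q \<in> convex hull {x \<in> S. n \<bullet> x = 0}"
proof -
  have sub: "convex hull S \<subseteq> {x. n \<bullet> x \<le> 0}"
    by (rule hull_minimal) (use le in \<open>auto simp: convex_halfspace_le\<close>)
  then have "(convex hull S \<inter> {x. n \<bullet> x = 0}) face_of convex hull S"
    by (intro face_of_Int_supporting_hyperplane_le) auto
  then obtain S' where S': "S' \<subseteq> S" "convex hull S \<inter> {x. n \<bullet> x = 0} = convex hull S'"
    using face_of_convex_hull_subset[OF finite_imp_compact[OF assms(1)]] by metis
  then have "S' \<subseteq> {x \<in> S. n \<bullet> x = 0}" using hull_subset[of S' convex] by blast
  then show ?thesis using q S'(2) hull_mono[of S' _ convex] by blast
qed

text \<open>The plane passes through the origin, so it separates the cones over \<open>f\<close> and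
  \<open>g\<close> and not only the triangles. The condition is asymmetric: \<open>f\<close> may
  touch the plane anywhere, \<open>g\<close> only in common vertices.\<close>

definition separates :: "(nat \<Rightarrow> real^3) \<Rightarrow> real^3 \<Rightarrow> nat set \<Rightarrow> nat set \<Rightarrow> bool" where
  "separates pos n f g \<longleftrightarrow> (\<forall>v\<in>f. 0 \<le> n \<bullet> pos v) \<and>
    (\<forall>w\<in>g. n \<bullet> pos w < 0 \<or> w \<in> f \<and> n \<bullet> pos w = 0)"

text \<open>The sign of \<open>n\<close> does not change along a ray, so \<open>p\<close> and
  \<open>c *\<^sub>R p\<close> may be different points. The case \<open>c = 1\<close> gives
  embeddedness, general \<open>c\<close> that a ray meets the surface only once.\<close>

lemma separates_common:
  assumes sep: "separates pos n f g" and "finite g" "c > 0"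
    and p: "p \<in> tri pos f" and cp: "c *\<^sub>R p \<in> tri pos g"
  shows "c *\<^sub>R p \<in> tri pos (f \<inter> g)"
proof -
  have "tri pos f \<subseteq> {x. n \<bullet> x \<ge> 0}" unfolding tri_def
    by (rule hull_minimal) (use sep in \<open>auto simp: convex_halfspace_ge separates_def\<close>)
  then have ge: "n \<bullet> (c *\<^sub>R p) \<ge> 0" using p \<open>c > 0\<close> by auto
  have le: "n \<bullet> x \<le> 0" if "x \<in> pos ` g" for x using sep that by (auto simp: separates_def)
  have "tri pos g \<subseteq> {x. n \<bullet> x \<le> 0}" unfolding tri_def
    by (rule hull_minimal) (use le in \<open>auto simp: convex_halfspace_le\<close>)
  then have "n \<bullet> (c *\<^sub>R p) \<le> 0" using cp by auto
  with ge have "n \<bullet> (c *\<^sub>R p) = 0" by (rule antisym[rotated])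
  then have "c *\<^sub>R p \<in> convex hull {x \<in> pos ` g. n \<bullet> x = 0}"
    using convex_hull_support[of "pos ` g" n "c *\<^sub>R p"] le cp assms(2) unfolding tri_def by auto
  also have "\<dots> \<subseteq> tri pos (f \<inter> g)" unfolding tri_def
    by (rule hull_mono) (use sep in \<open>auto simp: separates_def\<close>)
  finally show ?thesis .
qed

lemma tri_mono: "f \<subseteq> g \<Longrightarrow> tri pos f \<subseteq> tri pos g"
  unfolding tri_def by (intro hull_mono image_mono)

text \<open>\<open>plane\<close> keeps the origin off the plane of each face, so a ray meets a
  single face at most once; \<open>separated\<close> extends this to different faces;
  \<open>covers\<close> says that each ray meets some face.\<close>

locale radial_complex =
  fixes pos :: "nat \<Rightarrow> real^3" and F :: "nat set set"
  assumes finite_F: "finite F" and finite_face: "\<And>f. f \<in> F \<Longrightarrow> finite f"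
    and plane: "\<And>f. f \<in> F \<Longrightarrow> \<exists>m. \<forall>v\<in>f. m \<bullet> pos v = 1"
    and separated: "\<And>f g. f \<in> F \<Longrightarrow> g \<in> F \<Longrightarrow> f \<noteq> g \<Longrightarrow>
      \<exists>n. separates pos n f g \<or> separates pos n g f"
    and covers: "\<And>p. p \<noteq> 0 \<Longrightarrow> \<exists>f\<in>F. \<exists>c>0. c *\<^sub>R p \<in> tri pos f"
begin

text \<open>Separation places one of the two points in the face of the other, and the plane equation
  of that face admits one point per ray.\<close>

lemma ray_unique:
  assumes f: "f \<in> F" and g: "g \<in> F" and c: "c > 0" and p: "p \<in> tri pos f" and cp: "c *\<^sub>R p \<in> tri pos g"
  shows "c = 1"
proof -
  have same: "c = 1" if h: "h \<in> F" "p \<in> tri pos h" "c *\<^sub>R p \<in> tri pos h" for h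
  proof -
    obtain m where m: "\<forall>v\<in>h. m \<bullet> pos v = 1" using plane[OF h(1)] by blast
    have "tri pos h \<subseteq> {x. m \<bullet> x = 1}" unfolding tri_def
      by (rule hull_minimal) (use m in \<open>auto simp: convex_hyperplane\<close>)
    then have "m \<bullet> p = 1" "m \<bullet> (c *\<^sub>R p) = 1" using h by auto
    then show ?thesis by simp
  qed
  show ?thesis
  proof (cases "f = g")
    case True
    then show ?thesis using same f p cp by blast
  next
    case False
    then obtain n where "separates pos n f g \<or> separates pos n g f" using separated f g by blast
    then show ?thesis
    proof
      assume "separates pos n f g"
      then have "c *\<^sub>R p \<in> tri pos (f \<inter> g)"
        using separates_common finite_face[OF g] c p cp by blast
      then show ?thesis using same[OF f p] tri_mono[of "f \<inter> g" f] by blast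
    next
      assume *: "separates pos n g f"
      have "(1 / c) *\<^sub>R (c *\<^sub>R p) \<in> tri pos (g \<inter> f)"
        by (rule separates_common[OF * finite_face[OF f] _ cp]) (use c p in auto)
      then have "p \<in> tri pos (g \<inter> f)" using c by simp
      then show ?thesis using same[OF g _ cp] tri_mono[of "g \<inter> f" g] by blast
    qed
  qed
qed

lemma tri_Int:
  assumes f: "f \<in> F" and g: "g \<in> F"
  shows "tri pos f \<inter> tri pos g = tri pos (f \<inter> g)"
proof (cases "f = g")
  case False
  then obtain n where "separates pos n f g \<or> separates pos n g f" using separated f g by blast
  then have "tri pos f \<inter> tri pos g \<subseteq> tri pos (f \<inter> g)"
    using separates_common[of pos n f g 1] separates_common[of pos n g f 1]
      finite_face[OF f] finite_face[OF g] by (auto simp: Int_commute)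
  then show ?thesis using tri_mono[of "f \<inter> g" f] tri_mono[of "f \<inter> g" g] by blast
qed simp

lemma zero_notin: "0 \<notin> surface pos F"
proof
  assume "0 \<in> surface pos F"
  then obtain f where f: "f \<in> F" "0 \<in> tri pos f" by (auto simp: surface_def)
  then have "2 *\<^sub>R 0 \<in> tri pos f" by simp
  then show False using ray_unique[of f f 2 0] f by simp
qed

lemma surface_ray_unique:
  "p \<in> surface pos F \<Longrightarrow> c *\<^sub>R p \<in> surface pos F \<Longrightarrow> c > 0 \<Longrightarrow> c = 1"
  unfolding surface_def using ray_unique by blast

lemma compact_surface: "compact (surface pos F)"
  unfolding surface_def tri_def
  by (intro compact_UN finite_F compact_convex_hull finite_imp_compact finite_imageI finite_face)

lemma surface_homeomorphic_sphere: "surface pos F homeomorphic sphere (0::real^3) 1"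
proof (rule homeomorphic_compact)
  let ?h = "\<lambda>x::real^3. (1 / norm x) *\<^sub>R x"
  show "compact (surface pos F)" by (rule compact_surface)
  show "continuous_on (surface pos F) ?h"
    using zero_notin by (intro continuous_intros) auto
  show "?h ` surface pos F = sphere 0 1"
  proof
    show "?h ` surface pos F \<subseteq> sphere 0 1" using zero_notin by auto
    show "sphere 0 1 \<subseteq> ?h ` surface pos F"
    proof
      fix p :: "real^3" assume p: "p \<in> sphere 0 1"
      then have "p \<noteq> 0" by auto
      then obtain f c where c: "f \<in> F" "c > 0" "c *\<^sub>R p \<in> tri pos f" using covers by blast
      show "p \<in> ?h ` surface pos F"
      proof (rule image_eqI)
        show "p = ?h (c *\<^sub>R p)" using p c(2) by simp
        show "c *\<^sub>R p \<in> surface pos F" using c by (auto simp: surface_def)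
      qed
    qed
  qed
  show "inj_on ?h (surface pos F)"
  proof
    fix x y assume xy: "x \<in> surface pos F" "y \<in> surface pos F" "?h x = ?h y"
    have n: "norm x > 0" "norm y > 0" using xy zero_notin by auto
    have "norm y *\<^sub>R ?h x = norm y *\<^sub>R ?h y" unfolding xy(3) ..
    then have y: "y = (norm y / norm x) *\<^sub>R x" using n by simp
    then have "norm y / norm x = 1" using surface_ray_unique[of x "norm y / norm x"] xy n by simp
    then show "x = y" using y by (metis scaleR_one)
  qed
qed

text \<open>A compact set without interior is its own frontier, so the surface itself witnesses the
  frontier condition of the definition.\<close>

lemma frontier_surface: "frontier (surface pos F) = surface pos F"
proof -
  have "interior (surface pos F) = {}"
  proof (rule ccontr)
    assume "interior (surface pos F) \<noteq> {}"
    then obtain x e where x: "e > 0" "ball x e \<subseteq> surface pos F"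
      by (auto simp: mem_interior)
    have x0: "x \<in> surface pos F" using x by (meson centre_in_ball subsetD)
    then have "norm x > 0" using zero_notin by auto
    \<comment> \<open>Moves \<open>x\<close> outwards by \<open>e / 2\<close>, which stays in the
      ball but on the same ray.\<close>
    define c where "c = 1 + e / (2 * norm x)"
    have c: "c > 1" using x \<open>norm x > 0\<close> by (simp add: c_def)
    have "c *\<^sub>R x - x = (c - 1) *\<^sub>R x" by (simp add: scaleR_left_diff_distrib)
    then have "norm (c *\<^sub>R x - x) = (c - 1) * norm x" using c by simp
    then have "dist x (c *\<^sub>R x) = (c - 1) * norm x"
      by (simp add: dist_norm norm_minus_commute)
    also have "\<dots> = e / 2" using \<open>norm x > 0\<close> by (simp add: c_def)
    finally have "c *\<^sub>R x \<in> surface pos F" using x by (auto simp: subset_iff)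
    then have "c = 1" by (rule surface_ray_unique[OF x0]) (use c in simp)
    then show False using c by simp
  qed
  then show ?thesis
    using compact_surface by (simp add: frontier_def compact_imp_closed)
qed

end

section \<open>Covering the cone over a tetrahedron face by the cones over its hat\<close>

definition cone3 :: "'a::real_vector \<Rightarrow> 'a \<Rightarrow> 'a \<Rightarrow> 'a \<Rightarrow> bool" where
  "cone3 P Q R p \<longleftrightarrow> (\<exists>u v w. 0 \<le> u \<and> 0 \<le> v \<and> 0 \<le> w \<and> p = u *\<^sub>R P + v *\<^sub>R Q + w *\<^sub>R R)"

lemma cone3_swap: "cone3 P Q R p \<Longrightarrow> cone3 Q P R p"
  unfolding cone3_def by (metis add.commute)

lemma cone3_rotate: "cone3 P Q R p \<Longrightarrow> cone3 Q R P p"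
  unfolding cone3_def by (metis add.commute add.assoc)

text \<open>One of the six chambers given by the order of the coefficients; the others follow by
  symmetry in \<open>hat_covers\<close>. Three faces meet this chamber. The plane of
  \<open>C\<close> and \<open>y\<close> is \<open>5 * \<beta> = 4 * \<alpha>\<close>, the plane of
  \<open>x\<close> and \<open>y\<close> is \<open>5 * (\<alpha> + \<beta>) = 9 * \<gamma>\<close>;
  they divide the chamber among the three cones.\<close>

lemma hat_sector_covers:
  fixes A B C :: "'a::real_vector"
  assumes "0 \<le> \<beta>" "\<beta> \<le> \<alpha>" "\<alpha> \<le> \<gamma>"
    and p: "p = \<alpha> *\<^sub>R A + \<beta> *\<^sub>R B + \<gamma> *\<^sub>R C"
    and x: "x = 2 *\<^sub>R A + (5/2) *\<^sub>R B + (5/2) *\<^sub>R C"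
    and y: "y = (5/2) *\<^sub>R A + 2 *\<^sub>R B + (5/2) *\<^sub>R C"
    and t: "t = 8 *\<^sub>R A + 8 *\<^sub>R B + 8 *\<^sub>R C"
  shows "cone3 y (2 *\<^sub>R C) (2 *\<^sub>R A) p \<or> cone3 (2 *\<^sub>R C) x y p \<or> cone3 t x y p"
proof (cases "5 * \<beta> \<le> 4 * \<alpha>")
  case True
  define q r where "q = (\<alpha> - 5 / 4 * \<beta>) / 2" and "r = (\<gamma> - 5 / 4 * \<beta>) / 2"
  then have \<alpha>: "\<alpha> = 5 / 4 * \<beta> + 2 * q" and \<gamma>: "\<gamma> = 5 / 4 * \<beta> + 2 * r" by simp_all
  have "cone3 y (2 *\<^sub>R C) (2 *\<^sub>R A) p"
    unfolding cone3_def
  proof (intro exI conjI)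
    show "0 \<le> \<beta> / 2" "0 \<le> r" "0 \<le> q" using assms True by (auto simp: q_def r_def)
    show "p = (\<beta> / 2) *\<^sub>R y + r *\<^sub>R 2 *\<^sub>R C + q *\<^sub>R 2 *\<^sub>R A"
      unfolding p y \<alpha> \<gamma> by (simp add: scaleR_right_distrib scaleR_left_distrib mult.commute)
  qed
  then show ?thesis by blast
next
  case False
  show ?thesis
  proof (cases "5 * (\<alpha> + \<beta>) \<le> 9 * \<gamma>")
    case True
    have "cone3 (2 *\<^sub>R C) x y p"
      unfolding cone3_def
    proof (intro exI conjI)
      show "0 \<le> (\<gamma> - 5 / 9 * (\<alpha> + \<beta>)) / 2" "0 \<le> (10 * \<beta> - 8 * \<alpha>) / 9" "0 \<le> (10 * \<alpha> - 8 * \<beta>) / 9"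
        using assms True False by auto
      have "((\<gamma> - 5 / 9 * (\<alpha> + \<beta>)) / 2) *\<^sub>R 2 *\<^sub>R C + ((10 * \<beta> - 8 * \<alpha>) / 9) *\<^sub>R x + ((10 * \<alpha> - 8 * \<beta>) / 9) *\<^sub>R y
        = (2 * ((10 * \<beta> - 8 * \<alpha>) / 9) + 5 / 2 * ((10 * \<alpha> - 8 * \<beta>) / 9)) *\<^sub>R A
        + (5 / 2 * ((10 * \<beta> - 8 * \<alpha>) / 9) + 2 * ((10 * \<alpha> - 8 * \<beta>) / 9)) *\<^sub>R B
        + ((\<gamma> - 5 / 9 * (\<alpha> + \<beta>)) + 5 / 2 * ((10 * \<beta> - 8 * \<alpha>) / 9) + 5 / 2 * ((10 * \<alpha> - 8 * \<beta>) / 9)) *\<^sub>R C"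
        unfolding x y by (simp add: scaleR_right_distrib scaleR_left_distrib mult.commute)
      also have "\<dots> = p" unfolding p by (simp add: field_simps)
      finally show "p = ((\<gamma> - 5 / 9 * (\<alpha> + \<beta>)) / 2) *\<^sub>R 2 *\<^sub>R C + ((10 * \<beta> - 8 * \<alpha>) / 9) *\<^sub>R x + ((10 * \<alpha> - 8 * \<beta>) / 9) *\<^sub>R y" ..
    qed
    then show ?thesis by blast
  next
    case False
    have "cone3 t x y p"
      unfolding cone3_def
    proof (intro exI conjI)
      let ?t = "(5 * \<alpha> + 5 * \<beta> - 9 * \<gamma>) / 8" and ?x = "2 * (\<gamma> - \<alpha>)" and ?y = "2 * (\<gamma> - \<beta>)"
      show "0 \<le> ?t" "0 \<le> ?x" "0 \<le> ?y" using assms False by auto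
      have "?t *\<^sub>R t + ?x *\<^sub>R x + ?y *\<^sub>R y = (8 * ?t + 2 * ?x + 5 / 2 * ?y) *\<^sub>R A
        + (8 * ?t + 5 / 2 * ?x + 2 * ?y) *\<^sub>R B + (8 * ?t + 5 / 2 * ?x + 5 / 2 * ?y) *\<^sub>R C"
        unfolding x y t by (simp add: scaleR_right_distrib scaleR_left_distrib mult.commute)
      also have "\<dots> = p" unfolding p by (simp add: field_simps)
      finally show "p = ?t *\<^sub>R t + ?x *\<^sub>R x + ?y *\<^sub>R y" ..
    qed
    then show ?thesis by blast
  qed
qed

lemma hat_covers:
  fixes A B C :: "'a::real_vector"
  assumes "0 \<le> \<alpha>" "0 \<le> \<beta>" "0 \<le> \<gamma>"
    and p: "p = \<alpha> *\<^sub>R A + \<beta> *\<^sub>R B + \<gamma> *\<^sub>R C"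
    and x: "x = 2 *\<^sub>R A + (5/2) *\<^sub>R B + (5/2) *\<^sub>R C"
    and y: "y = (5/2) *\<^sub>R A + 2 *\<^sub>R B + (5/2) *\<^sub>R C"
    and z: "z = (5/2) *\<^sub>R A + (5/2) *\<^sub>R B + 2 *\<^sub>R C"
    and t: "t = 8 *\<^sub>R A + 8 *\<^sub>R B + 8 *\<^sub>R C"
    and c: "a = 2 *\<^sub>R A" "b = 2 *\<^sub>R B" "c = 2 *\<^sub>R C"
  shows "cone3 t x y p \<or> cone3 t y z p \<or> cone3 t z x p \<or> cone3 a y z p \<or> cone3 b z x p \<or>
    cone3 c x y p \<or> cone3 x b c p \<or> cone3 y c a p \<or> cone3 z a b p"
proof -
  note sec = hat_sector_covers[where p = p and t = t]
  note perm = cone3_swap cone3_rotate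
  consider "\<beta> \<le> \<alpha> \<and> \<alpha> \<le> \<gamma>" | "\<alpha> \<le> \<beta> \<and> \<beta> \<le> \<gamma>" | "\<gamma> \<le> \<alpha> \<and> \<alpha> \<le> \<beta>" | "\<alpha> \<le> \<gamma> \<and> \<gamma> \<le> \<beta>"
    | "\<beta> \<le> \<gamma> \<and> \<gamma> \<le> \<alpha>" | "\<gamma> \<le> \<beta> \<and> \<beta> \<le> \<alpha>" by linarith
  then show ?thesis
  proof cases
    case 1
    have "cone3 y c a p \<or> cone3 c x y p \<or> cone3 t x y p"
      unfolding c by (rule sec[where \<alpha> = \<alpha> and \<beta> = \<beta> and \<gamma> = \<gamma> and A = A and B = B and C = C])
        (use 1 assms in \<open>simp_all add: ac_simps\<close>)
    then show ?thesis by blast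
  next
    case 2
    have "cone3 x c b p \<or> cone3 c y x p \<or> cone3 t y x p"
      unfolding c by (rule sec[where \<alpha> = \<beta> and \<beta> = \<alpha> and \<gamma> = \<gamma> and A = B and B = A and C = C])
        (use 2 assms in \<open>simp_all add: ac_simps\<close>)
    then show ?thesis using perm by metis
  next
    case 3
    have "cone3 z b a p \<or> cone3 b x z p \<or> cone3 t x z p"
      unfolding c by (rule sec[where \<alpha> = \<alpha> and \<beta> = \<gamma> and \<gamma> = \<beta> and A = A and B = C and C = B])
        (use 3 assms in \<open>simp_all add: ac_simps\<close>)
    then show ?thesis using perm by metis
  next
    case 4
    have "cone3 x b c p \<or> cone3 b z x p \<or> cone3 t z x p"
      unfolding c by (rule sec[where \<alpha> = \<gamma> and \<beta> = \<alpha> and \<gamma> = \<beta> and A = C and B = A and C = B])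
        (use 4 assms in \<open>simp_all add: ac_simps\<close>)
    then show ?thesis by blast
  next
    case 5
    have "cone3 y a c p \<or> cone3 a z y p \<or> cone3 t z y p"
      unfolding c by (rule sec[where \<alpha> = \<gamma> and \<beta> = \<beta> and \<gamma> = \<alpha> and A = C and B = B and C = A])
        (use 5 assms in \<open>simp_all add: ac_simps\<close>)
    then show ?thesis using perm by metis
  next
    case 6
    have "cone3 z a b p \<or> cone3 a y z p \<or> cone3 t y z p"
      unfolding c by (rule sec[where \<alpha> = \<beta> and \<beta> = \<gamma> and \<gamma> = \<alpha> and A = B and B = C and C = A])
        (use 6 assms in \<open>simp_all add: ac_simps\<close>)
    then show ?thesis by blast
  qed
qed

lemma cone3_meets_tri:
  assumes "cone3 (pos i) (pos j) (pos k) p" "p \<noteq> 0"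
  shows "\<exists>c>0. c *\<^sub>R p \<in> tri pos {i, j, k}"
proof -
  obtain u v w where u: "0 \<le> u" "0 \<le> v" "0 \<le> w" "p = u *\<^sub>R pos i + v *\<^sub>R pos j + w *\<^sub>R pos k"
    using assms(1) unfolding cone3_def by blast
  define s where "s = u + v + w"
  have "s \<noteq> 0"
  proof
    assume "s = 0"
    then have "u = 0" "v = 0" "w = 0" using u(1-3) by (auto simp: s_def)
    then show False using u(4) assms(2) by simp
  qed
  then have s: "s > 0" using u(1-3) by (simp add: s_def)
  have "(1 / s) *\<^sub>R p = (u / s) *\<^sub>R pos i + (v / s) *\<^sub>R pos j + (w / s) *\<^sub>R pos k"
    unfolding u(4) by (simp add: scaleR_right_distrib)
  moreover have "u / s + v / s + w / s = 1"
    using s by (simp add: add_divide_distrib[symmetric] s_def)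
  ultimately have "(1 / s) *\<^sub>R p \<in> tri pos {i, j, k}"
    unfolding tri_def using u(1-3) s
    by (simp add: convex_hull_3_iff)
      (rule exI[of _ "u / s"], simp, rule exI[of _ "v / s"], simp, rule exI[of _ "w / s"], simp)
  then show ?thesis using s by (intro exI[of _ "1 / s"]) simp
qed

subsection \<open>The hatted tetrahedron\<close>

text \<open>Integer coordinates make the finite checks executable by \<open>code_simp\<close>;
  \<open>emb\<close> later carries them over to real space.\<close>

type_synonym int3 = "int \<times> int \<times> int"

fun dot3 :: "int3 \<Rightarrow> int3 \<Rightarrow> int" where
  "dot3 (a, b, c) (d, e, f) = a * d + b * e + c * f"

fun sub3 :: "int3 \<Rightarrow> int3 \<Rightarrow> int3" where
  "sub3 (a, b, c) (d, e, f) = (a - d, b - e, c - f)"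

fun vec_prod :: "int3 \<Rightarrow> int3 \<Rightarrow> int3" where
  "vec_prod (a, b, c) (d, e, f) = (b * f - c * e, c * d - a * f, a * e - b * d)"

definition sqdist3 :: "int3 \<Rightarrow> int3 \<Rightarrow> int" where
  "sqdist3 p q = dot3 (sub3 p q) (sub3 p q)"

definition normal3 :: "int3 list \<Rightarrow> int3" where
  "normal3 f = vec_prod (sub3 (f ! 1) (f ! 0)) (sub3 (f ! 2) (f ! 0))"

text \<open>With the tetrahedron spanned by the vectors a(i) = (1,1,1), (1,-1,-1), (-1,1,-1), (-1,-1,1), the
  corner i is 2 a(i).  The block of four vertices starting at 4 + 4 h is the hat over the face opposite
  to corner h: its tip -8 a(h), followed by the inner vertices -(5 a(h) + a(j)) / 2 in the order of the
  corners j given in faces.\<close>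

definition vertices :: "int3 list" where
  "vertices = [(2,2,2), (2,-2,-2), (-2,2,-2), (-2,-2,2),
    (-8,-8,-8), (-3,-2,-2), (-2,-3,-2), (-2,-2,-3),
    (-8,8,8), (-3,2,2), (-2,3,2), (-2,2,3),
    (8,-8,8), (3,-2,2), (2,-3,2), (2,-2,3),
    (8,8,-8), (3,2,-2), (2,3,-2), (2,2,-3)]"

definition hat_faces :: "nat \<Rightarrow> nat \<Rightarrow> nat \<Rightarrow> nat \<Rightarrow> nat \<Rightarrow> nat \<Rightarrow> nat \<Rightarrow> nat list list" where
  "hat_faces t x y z a b c = [[t, x, y], [t, y, z], [t, z, x], [a, y, z], [b, z, x], [c, x, y],
    [x, b, c], [y, c, a], [z, a, b]]"

definition faces :: "nat list list" where
  "faces = hat_faces 4 5 6 7 1 2 3 @ hat_faces 8 9 10 11 0 3 2 @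
    hat_faces 12 13 14 15 3 0 1 @ hat_faces 16 17 18 19 2 1 0"

definition coords :: "nat list \<Rightarrow> int3 list" where
  "coords f = map ((!) vertices) f"

text \<open>Found by search: for any two faces, some plane through the origin with one of these normals
  weakly separates them and meets one of the two only in common vertices.\<close>

definition normals :: "int3 list" where
  "normals = [(2,-5,2), (2,-2,5), (-5,-2,-2), (1,0,1), (1,0,-1), (0,1,1), (0,1,-1), (1,-1,0), (1,1,0),
    (-4,-5,-1), (-5,4,1), (1,-5,4), (-5,-1,-4), (-4,1,5), (-1,-4,-5), (4,1,-5), (4,-1,5),
    (-5,1,4), (5,4,-1), (1,-4,5), (5,1,-4), (2,2,5), (-1,-1,0), (5,-2,-2), (1,-5,-4), (-1,0,-1),
    (1,5,4), (0,-1,1), (2,-2,-5), (2,-5,-2), (2,5,2), (1,-4,-5), (-4,5,-1), (-5,2,-2), (5,-1,4),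
    (-1,-4,5), (5,4,1), (2,2,-5), (-5,4,-1), (5,2,-2), (4,5,-1), (2,5,-2), (-4,5,1), (-4,-1,-5),
    (1,5,-4)]"

type_synonym side = "bool \<times> bool \<times> int3 list"

text \<open>Evaluated once for each face and normal, so that comparing a pair of faces needs only
  stored signs and the vertices on the plane.\<close>

definition side :: "int3 list \<Rightarrow> int3 \<Rightarrow> side" where
  "side f n = (\<forall>v\<in>set f. 0 \<le> dot3 n v, \<forall>v\<in>set f. dot3 n v \<le> 0, filter (\<lambda>v. dot3 n v = 0) f)"

definition one_sided :: "int3 list \<Rightarrow> side \<Rightarrow> side \<Rightarrow> bool" where
  "one_sided f s s' \<longleftrightarrow> (if fst s then if fst (snd s') then \<forall>w\<in>set (snd (snd s')). w \<in> set f else False else False)"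

text \<open>Nested conditionals, because the simplifier does not evaluate conjunctions lazily.\<close>

fun separable :: "int3 list \<Rightarrow> int3 list \<Rightarrow> side list \<Rightarrow> side list \<Rightarrow> bool" where
  "separable f g (s # ss) (s' # ss') =
    (if one_sided f s s' then True else if one_sided g s' s then True else separable f g ss ss')"
| "separable f g _ _ = False"

text \<open>\<open>sorted_wrt\<close> serves as a quantifier over unordered pairs of faces, halving
  the evaluation; \<open>faces_pairwise\<close> reads the result back.\<close>

lemma faces_separable:
  "sorted_wrt (\<lambda>(f, s) (g, s'). separable f g s s') (map (\<lambda>f. (f, map (side f) normals)) (map coords faces))"
  by code_simp

lemma faces_distinct_sets: "sorted_wrt (\<lambda>f g. \<exists>v\<in>set f. v \<notin> set g) faces"
  by code_simp

lemma faces_triples: "\<forall>f\<in>set faces. length f = 3 \<and> distinct f \<and> (\<forall>v\<in>set f. v < 20)"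
  by code_simp

lemma faces_cover_vertices: "list_all (\<lambda>v. \<exists>f\<in>set faces. v \<in> set f) [0..<20]"
  by code_simp

lemma vertices_distinct: "distinct vertices"
  by code_simp

lemma edge_in_two_faces:
  "\<forall>f\<in>set faces. \<forall>e\<in>set [[f ! 0, f ! 1], [f ! 1, f ! 2], [f ! 2, f ! 0]].
    length (filter (\<lambda>g. \<forall>v\<in>set e. v \<in> set g) faces) = 2"
  by code_simp

lemma faces_planes:
  "\<forall>f\<in>set (map coords faces). dot3 (normal3 f) (f ! 0) \<noteq> 0 \<and>
    (\<forall>v\<in>set f. dot3 (normal3 f) v = dot3 (normal3 f) (f ! 0))"
  by code_simp

lemma faces_acute_isosceles:
  "\<forall>f\<in>set (map coords faces).
    dot3 (sub3 (f ! 1) (f ! 0)) (sub3 (f ! 2) (f ! 0)) > 0 \<and>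
    dot3 (sub3 (f ! 0) (f ! 1)) (sub3 (f ! 2) (f ! 1)) > 0 \<and>
    dot3 (sub3 (f ! 0) (f ! 2)) (sub3 (f ! 1) (f ! 2)) > 0 \<and>
    (sqdist3 (f ! 0) (f ! 1) = sqdist3 (f ! 0) (f ! 2) \<or>
     sqdist3 (f ! 1) (f ! 0) = sqdist3 (f ! 1) (f ! 2) \<or>
     sqdist3 (f ! 2) (f ! 0) = sqdist3 (f ! 2) (f ! 1))"
  by code_simp

definition bent :: "int3 list \<times> int3 \<Rightarrow> int3 list \<times> int3 \<Rightarrow> bool" where
  "bent p q \<longleftrightarrow> (if length (filter (\<lambda>w. w \<in> set (fst p)) (fst q)) = 2
    then \<forall>w\<in>set (fst q). w \<notin> set (fst p) \<longrightarrow> dot3 (snd p) w \<noteq> dot3 (snd p) (fst p ! 0) else True)"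

lemma faces_bent: "sorted_wrt bent (map (\<lambda>f. (f, normal3 f)) (map coords faces))"
  by code_simp

section \<open>Transfer of the integer checks to real space\<close>

fun emb :: "int3 \<Rightarrow> real^3" where
  "emb (a, b, c) = vector [real_of_int a, real_of_int b, real_of_int c]"

lemma emb_nth: "emb p $ 1 = fst p" "emb p $ 2 = fst (snd p)" "emb p $ 3 = snd (snd p)"
  by (cases p; simp)+

lemma inner_emb: "emb p \<bullet> emb q = real_of_int (dot3 p q)"
  by (cases p; cases q) (simp add: inner_vec_def sum_3)

lemma emb_sub: "emb (sub3 p q) = emb p - emb q"
  by (cases p; cases q) (simp add: vec_eq_iff forall_3)

lemma emb_vec_prod: "emb (vec_prod p q) = cross3 (emb p) (emb q)"
  by (cases p; cases q) (simp add: vec_eq_iff forall_3 cross3_def)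

lemma dist_emb: "(dist (emb p) (emb q))\<^sup>2 = real_of_int (sqdist3 p q)"
  by (simp add: dist_norm power2_norm_eq_inner sqdist3_def inner_emb emb_sub[symmetric])

definition vertex_pos :: "nat \<Rightarrow> real^3" where
  "vertex_pos v = emb (vertices ! v)"

definition face_sets :: "nat set set" where
  "face_sets = set ` set faces"

lemma inner_pos: "emb n \<bullet> vertex_pos v = real_of_int (dot3 n (vertices ! v))"
  by (simp add: vertex_pos_def inner_emb)

lemma length_vertices: "length vertices = 20"
  by (simp add: vertices_def)

lemma faceE:
  assumes "f \<in> face_sets"
  obtains a b c where "[a, b, c] \<in> set faces" "f = {a, b, c}" "a \<noteq> b" "b \<noteq> c" "a \<noteq> c"
    "a < 20" "b < 20" "c < 20"
proof -
  obtain l where l: "l \<in> set faces" "f = set l" using assms by (auto simp: face_sets_def)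
  have l3: "length l = 3 \<and> distinct l \<and> (\<forall>v\<in>set l. v < 20)" using faces_triples l(1) by (rule bspec)
  then obtain a b c where "l = [a, b, c]" by (auto simp: numeral_3_eq_3 length_Suc_conv)
  then show thesis using that l l3 by auto
qed

lemma coords_triple: "coords [a, b, c] = [vertices ! a, vertices ! b, vertices ! c]"
  by (simp add: coords_def)

lemma vertex_inj: "u < 20 \<Longrightarrow> v < 20 \<Longrightarrow> vertices ! u = vertices ! v \<longleftrightarrow> u = v"
  using vertices_distinct by (simp add: nth_eq_iff_index_eq length_vertices)

lemma face_lt_20: "f \<in> face_sets \<Longrightarrow> v \<in> f \<Longrightarrow> v < 20"
  using faces_triples by (auto simp: face_sets_def)

lemma Union_face_sets: "\<Union>face_sets = {..<20}"
proof
  show "\<Union>face_sets \<subseteq> {..<20}" using face_lt_20 by auto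
  show "{..<20} \<subseteq> \<Union>face_sets" using faces_cover_vertices by (auto simp: list_all_iff face_sets_def)
qed

lemma inj_pos: "inj_on vertex_pos (\<Union>face_sets)"
proof (rule inj_onI)
  fix u v assume uv: "u \<in> \<Union>face_sets" "v \<in> \<Union>face_sets" "vertex_pos u = vertex_pos v"
  have "p = q" if "emb p = emb q" for p q
    using that by (metis emb_nth of_int_eq_iff prod.expand)
  then have "vertices ! u = vertices ! v" using uv(3) by (simp add: vertex_pos_def)
  then show "u = v" using uv vertex_inj unfolding Union_face_sets by simp
qed

lemma finite_face_sets: "finite face_sets"
  by (simp add: face_sets_def)

lemma card_face: "f \<in> face_sets \<Longrightarrow> card f = 3"
  by (erule faceE) auto

lemma faces_inj: "inj_on set (set faces)" and faces_distinct: "distinct faces"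
proof -
  have ne: "set (faces ! i) \<noteq> set (faces ! j)" if "i < j" "j < length faces" for i j
    using faces_distinct_sets that unfolding sorted_wrt_iff_nth_less by blast
  then have ne': "set (faces ! i) \<noteq> set (faces ! j)"
    if "i \<noteq> j" "i < length faces" "j < length faces" for i j
    using that by (metis linorder_neqE_nat)
  show "inj_on set (set faces)"
  proof (rule inj_onI)
    fix k l assume "k \<in> set faces" "l \<in> set faces" "set k = set l"
    then show "k = l" using ne' by (metis in_set_conv_nth)
  qed
  show "distinct faces" unfolding distinct_conv_nth using ne' by metis
qed

lemma card_face_sets: "card face_sets = 36"
  unfolding face_sets_def card_image[OF faces_inj] distinct_card[OF faces_distinct]
  by (simp add: faces_def hat_faces_def)

lemma faces_pairwise:
  assumes "sorted_wrt P (map h faces)" "k \<in> set faces" "l \<in> set faces" "k \<noteq> l"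
  shows "P (h k) (h l) \<or> P (h l) (h k)"
proof -
  obtain i j where ij: "i < length faces" "j < length faces" "k = faces ! i" "l = faces ! j"
    using assms(2,3) by (metis in_set_conv_nth)
  then have "i \<noteq> j" using assms(4) by auto
  then show ?thesis
    using assms(1) ij unfolding sorted_wrt_iff_nth_less by (auto simp: neq_iff)
qed

lemma one_sided_separates:
  assumes "one_sided (coords f) (side (coords f) n) (side (coords g) n)"
    and "\<forall>v\<in>set f. v < 20" "\<forall>v\<in>set g. v < 20"
  shows "separates vertex_pos (emb n) (set f) (set g)"
proof -
  have *: "\<forall>v\<in>set f. 0 \<le> dot3 n (vertices ! v)" "\<forall>w\<in>set g. dot3 n (vertices ! w) \<le> 0"
    and common: "\<forall>p\<in>set (filter (\<lambda>v. dot3 n v = 0) (coords g)). p \<in> set (coords f)"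
    using assms(1)
    by (simp_all add: one_sided_def side_def coords_def del: split_paired_All split: if_splits)
  have "w \<in> set f" if w: "w \<in> set g" "dot3 n (vertices ! w) = 0" for w
  proof -
    have "vertices ! w \<in> set (filter (\<lambda>v. dot3 n v = 0) (coords g))"
      using w by (simp add: coords_def)
    then have "vertices ! w \<in> set (coords f)" using common by blast
    then obtain v where v: "v \<in> set f" "vertices ! w = vertices ! v" by (auto simp: coords_def)
    then have "w = v" using vertex_inj assms(2,3) w(1) by simp
    then show ?thesis using v(1) by simp
  qed
  then show ?thesis
    using *(1,2) unfolding separates_def inner_pos by (simp add: less_le)
qed

lemma separable_imp_separates:
  assumes "separable (coords f) (coords g) (map (side (coords f)) ns) (map (side (coords g)) ns)"
    and "\<forall>v\<in>set f. v < 20" "\<forall>v\<in>set g. v < 20"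
  shows "\<exists>n. separates vertex_pos n (set f) (set g) \<or> separates vertex_pos n (set g) (set f)"
  using assms(1)
proof (induction ns)
  case (Cons n ns)
  let ?f = "coords f" and ?g = "coords g"
  have "one_sided ?f (side ?f n) (side ?g n) \<or> one_sided ?g (side ?g n) (side ?f n) \<or>
      separable ?f ?g (map (side ?f) ns) (map (side ?g) ns)"
    using Cons.prems by (simp split: if_splits)
  then show ?case
    using one_sided_separates[OF _ assms(2,3)] one_sided_separates[OF _ assms(3,2)] Cons.IH by blast
qed simp

lemma face_sets_separated:
  assumes "f \<in> face_sets" "g \<in> face_sets" "f \<noteq> g"
  shows "\<exists>n. separates vertex_pos n f g \<or> separates vertex_pos n g f"
proof -
  obtain k l where kl: "k \<in> set faces" "l \<in> set faces" "f = set k" "g = set l"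
    using assms by (auto simp: face_sets_def)
  have lt: "\<forall>v\<in>set k. v < 20" "\<forall>v\<in>set l. v < 20" using faces_triples kl by auto
  have "k \<noteq> l" using kl assms by auto
  then have "separable (coords k) (coords l) (map (side (coords k)) normals) (map (side (coords l)) normals) \<or>
      separable (coords l) (coords k) (map (side (coords l)) normals) (map (side (coords k)) normals)"
    using faces_pairwise[OF faces_separable[unfolded map_map] kl(1,2)] by simp
  then show ?thesis
    using separable_imp_separates[of k l normals] separable_imp_separates[of l k normals] lt
    unfolding kl(3,4) by blast
qed

lemma face_normal:
  assumes "[a, b, c] \<in> set faces"
  defines "m \<equiv> cross3 (vertex_pos b - vertex_pos a) (vertex_pos c - vertex_pos a)"
  shows "m = emb (normal3 (coords [a, b, c]))" "m \<bullet> vertex_pos a \<noteq> 0"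
    "m \<bullet> vertex_pos b = m \<bullet> vertex_pos a" "m \<bullet> vertex_pos c = m \<bullet> vertex_pos a"
proof -
  show m: "m = emb (normal3 (coords [a, b, c]))"
    unfolding m_def vertex_pos_def normal3_def coords_triple by (simp add: emb_vec_prod emb_sub)
  have "coords [a, b, c] \<in> set (map coords faces)" using assms(1) by force
  from bspec[OF faces_planes this]
  show "m \<bullet> vertex_pos a \<noteq> 0" "m \<bullet> vertex_pos b = m \<bullet> vertex_pos a" "m \<bullet> vertex_pos c = m \<bullet> vertex_pos a"
    unfolding m inner_pos coords_triple by auto
qed

lemma face_plane: "f \<in> face_sets \<Longrightarrow> \<exists>m. \<forall>v\<in>f. m \<bullet> vertex_pos v = 1"
proof (erule faceE)
  fix a b c assume abc: "[a, b, c] \<in> set faces" "f = {a, b, c}"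
  let ?m = "cross3 (vertex_pos b - vertex_pos a) (vertex_pos c - vertex_pos a)"
  note n = face_normal(2-)[OF abc(1)]
  have "((1 / (?m \<bullet> vertex_pos a)) *\<^sub>R ?m) \<bullet> vertex_pos v = 1" if "v \<in> f" for v
    using that n abc(2) by auto
  then show ?thesis by blast
qed

lemma face_noncollinear:
  assumes "[a, b, c] \<in> set faces"
  shows "\<not> collinear {vertex_pos a, vertex_pos b, vertex_pos c}"
proof
  assume "collinear {vertex_pos a, vertex_pos b, vertex_pos c}"
  then have "collinear {vertex_pos b, vertex_pos a, vertex_pos c}" by (simp add: insert_commute)
  then have "collinear {0, vertex_pos b - vertex_pos a, vertex_pos c - vertex_pos a}"
    by (subst (asm) collinear_3) (simp_all add: NO_MATCH_def)
  then show False using face_normal(2)[OF assms] by (simp add: cross_eq_0[symmetric])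
qed

text \<open>Dimension count: the noncollinear triple already has affine dimension 2, so adding a
  coplanar \<open>D\<close> does not enlarge its affine hull.\<close>

lemma coplanar_imp_same_plane:
  fixes A B C D m :: "real^3"
  assumes nc: "\<not> collinear {A, B, C}" and cop: "coplanar (insert D {A, B, C})"
    and m: "m \<bullet> B = m \<bullet> A" "m \<bullet> C = m \<bullet> A"
  shows "m \<bullet> D = m \<bullet> A"
proof -
  have ne: "A \<noteq> B" "A \<noteq> C" "B \<noteq> C" and ind: "\<not> affine_dependent {A, B, C}"
    using nc by (auto simp: collinear_3_eq_affine_dependent)
  then have dim: "aff_dim {A, B, C} = 2"
    using aff_dim_affine_independent[OF ind] by simp
  obtain u v w where "insert D {A, B, C} \<subseteq> affine hull {u, v, w}"
    using cop unfolding coplanar_def by blast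
  then have "aff_dim (insert D {A, B, C}) \<le> aff_dim {u, v, w}"
    using aff_dim_subset[of "insert D {A, B, C}" "affine hull {u, v, w}"] by simp
  also have "\<dots> \<le> 2"
    using aff_dim_le_card[of "{u, v, w}"] card_insert_le_m1[of 3 "{v, w}" u]
      card_insert_le_m1[of 2 "{w}" v] by simp
  finally have "aff_dim (insert D {A, B, C}) = aff_dim {A, B, C}"
    using dim aff_dim_subset[of "{A, B, C}" "insert D {A, B, C}"] by auto
  then have "affine hull {A, B, C} = affine hull (insert D {A, B, C})"
    using aff_dim_eq_full_gen[of "{A, B, C}" "insert D {A, B, C}"] by auto
  then have "D \<in> affine hull {A, B, C}" by (simp add: hull_inc)
  moreover have "affine hull {A, B, C} \<subseteq> {x. m \<bullet> x = m \<bullet> A}"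
    by (rule hull_minimal) (use m in \<open>auto simp: affine_hyperplane\<close>)
  ultimately show ?thesis by auto
qed

lemma card_filter_distinct: "distinct l \<Longrightarrow> length (filter P l) = card {x \<in> set l. P x}"
  by (metis distinct_card distinct_filter set_filter)

lemma bent_not_coplanar:
  assumes k: "k \<in> set faces" "l \<in> set faces" and card: "card (set k \<inter> set l) = 2"
    and bent: "bent (coords k, normal3 (coords k)) (coords l, normal3 (coords l))"
  shows "\<not> coplanar (vertex_pos ` (set k \<union> set l))"
proof
  assume cop: "coplanar (vertex_pos ` (set k \<union> set l))"
  have k': "length k = 3 \<and> distinct k \<and> (\<forall>v\<in>set k. v < 20)"
    and l': "length l = 3 \<and> distinct l \<and> (\<forall>v\<in>set l. v < 20)"
    using faces_triples k by auto
  then obtain a b c where abc: "k = [a, b, c]" by (auto simp: numeral_3_eq_3 length_Suc_conv)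
  have mem: "vertices ! v \<in> set (coords k) \<longleftrightarrow> v \<in> set k" if "v < 20" for v
    using k' that by (auto simp: coords_def vertex_inj)
  have "filter (\<lambda>w. w \<in> set (coords k)) (coords l) = map ((!) vertices) (filter (\<lambda>v. v \<in> set k) l)"
    unfolding coords_def[of l] filter_map using l' mem by (auto intro!: arg_cong[where f = "map _"] filter_cong)
  then have "length (filter (\<lambda>w. w \<in> set (coords k)) (coords l)) = card {v \<in> set l. v \<in> set k}"
    using l' by (simp add: card_filter_distinct)
  also have "{v \<in> set l. v \<in> set k} = set k \<inter> set l" by auto
  finally have b: "\<forall>w\<in>set (coords l). w \<notin> set (coords k) \<longrightarrow>
      dot3 (normal3 (coords k)) w \<noteq> dot3 (normal3 (coords k)) (coords k ! 0)"
    using bent card by (simp add: bent_def)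
  have "card (set l) = 3" using l' distinct_card by metis
  then have "set k \<inter> set l \<noteq> set l" using card by auto
  then obtain d where d: "d \<in> set l" "d \<notin> set k" by blast
  let ?m = "cross3 (vertex_pos b - vertex_pos a) (vertex_pos c - vertex_pos a)"
  have "vertices ! d \<in> set (coords l)" using d by (simp add: coords_def)
  then have "dot3 (normal3 (coords k)) (vertices ! d) \<noteq> dot3 (normal3 (coords k)) (vertices ! a)"
    using b d mem[of d] l' by (auto simp: abc coords_triple)
  then have "?m \<bullet> vertex_pos d \<noteq> ?m \<bullet> vertex_pos a"
    unfolding face_normal(1)[OF k(1)[unfolded abc]] inner_pos by (simp add: abc)
  moreover have "?m \<bullet> vertex_pos d = ?m \<bullet> vertex_pos a"
  proof (rule coplanar_imp_same_plane)
    show "\<not> collinear {vertex_pos a, vertex_pos b, vertex_pos c}" by (rule face_noncollinear[OF k(1)[unfolded abc]])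
    show "coplanar (insert (vertex_pos d) {vertex_pos a, vertex_pos b, vertex_pos c})"
    proof -
      have "insert (vertex_pos d) {vertex_pos a, vertex_pos b, vertex_pos c} \<subseteq> vertex_pos ` (set k \<union> set l)" using d(1) abc by auto
      then show ?thesis using cop unfolding coplanar_def by (meson order.trans)
    qed
    show "?m \<bullet> vertex_pos b = ?m \<bullet> vertex_pos a" "?m \<bullet> vertex_pos c = ?m \<bullet> vertex_pos a"
      using face_normal(3,4)[OF k(1)[unfolded abc]] by auto
  qed
  ultimately show False by blast
qed

lemma adjacent_not_coplanar:
  assumes "f \<in> face_sets" "g \<in> face_sets" "f \<noteq> g" "card (f \<inter> g) = 2"
  shows "\<not> coplanar (vertex_pos ` (f \<union> g))"
proof -
  obtain k l where kl: "k \<in> set faces" "l \<in> set faces" "f = set k" "g = set l"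
    using assms by (auto simp: face_sets_def)
  have "k \<noteq> l" using kl assms by auto
  then have "bent (coords k, normal3 (coords k)) (coords l, normal3 (coords l)) \<or>
      bent (coords l, normal3 (coords l)) (coords k, normal3 (coords k))"
    using faces_pairwise[OF faces_bent[unfolded map_map] kl(1,2)] by simp
  then show ?thesis
    using bent_not_coplanar[OF kl(1,2)] bent_not_coplanar[OF kl(2,1)] assms(4)
    unfolding kl(3,4) by (auto simp: Int_commute Un_commute)
qed

lemma edge_two_faces:
  assumes "e \<in> edges face_sets"
  shows "card {f \<in> face_sets. e \<subseteq> f} = 2"
proof -
  obtain f where f: "card e = 2" "f \<in> face_sets" "e \<subseteq> f" using assms by (auto simp: edges_def)
  from f(2) obtain a b c where abc: "[a, b, c] \<in> set faces" "f = {a, b, c}" by (rule faceE)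
  have "e = {a, b} \<or> e = {b, c} \<or> e = {c, a}" using two_subset_of_triple[of e a b c] f abc by simp
  then have "\<exists>e'\<in>set [[a, b], [b, c], [c, a]]. e = set e'" by simp
  then obtain e' where e': "e = set e'" "e' \<in> set [[a, b], [b, c], [c, a]]" by blast
  have "length (filter (\<lambda>g. \<forall>v\<in>set e'. v \<in> set g) faces) = 2"
    using bspec[OF edge_in_two_faces abc(1)] e'(2) by auto
  then have "card {g \<in> set faces. e \<subseteq> set g} = 2"
    by (simp add: card_filter_distinct[OF faces_distinct] e'(1) subset_eq)
  moreover have "{f \<in> face_sets. e \<subseteq> f} = set ` {g \<in> set faces. e \<subseteq> set g}" by (auto simp: face_sets_def)
  moreover have "inj_on set {g \<in> set faces. e \<subseteq> set g}" by (rule inj_on_subset[OF faces_inj]) auto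
  ultimately show ?thesis by (simp add: card_image)
qed

lemma faces_acute: "f \<in> face_sets \<Longrightarrow> acute_isosceles_face vertex_pos f"
proof (erule faceE)
  fix a b c assume abc: "[a, b, c] \<in> set faces" "f = {a, b, c}"
  have "coords [a, b, c] \<in> set (map coords faces)" using abc(1) by force
  note ai = bspec[OF faces_acute_isosceles this]
  have d: "(vertex_pos u - vertex_pos v) \<bullet> (vertex_pos w - vertex_pos v) =
      real_of_int (dot3 (sub3 (vertices ! u) (vertices ! v)) (sub3 (vertices ! w) (vertices ! v)))" for u v w
    by (simp add: vertex_pos_def inner_emb[symmetric] emb_sub)
  have s: "dist (vertex_pos u) (vertex_pos v) = dist (vertex_pos u') (vertex_pos v')"
    if "sqdist3 (vertices ! u) (vertices ! v) = sqdist3 (vertices ! u') (vertices ! v')" for u v u' v'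
  proof -
    have "(dist (vertex_pos u) (vertex_pos v))\<^sup>2 = (dist (vertex_pos u') (vertex_pos v'))\<^sup>2"
      unfolding vertex_pos_def dist_emb that ..
    then show ?thesis by simp
  qed
  have "acute_isosceles (vertex_pos a) (vertex_pos b) (vertex_pos c)"
    unfolding acute_isosceles_def d
  proof (intro conjI)
    show "\<not> collinear {vertex_pos a, vertex_pos b, vertex_pos c}" by (rule face_noncollinear[OF abc(1)])
    have "sqdist3 (vertices ! a) (vertices ! b) = sqdist3 (vertices ! a) (vertices ! c) \<or>
        sqdist3 (vertices ! b) (vertices ! a) = sqdist3 (vertices ! b) (vertices ! c) \<or>
        sqdist3 (vertices ! c) (vertices ! a) = sqdist3 (vertices ! c) (vertices ! b)"
      using ai by (simp add: coords_triple)
    then show "dist (vertex_pos a) (vertex_pos b) = dist (vertex_pos a) (vertex_pos c) \<or> dist (vertex_pos b) (vertex_pos a) = dist (vertex_pos b) (vertex_pos c) \<or>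
        dist (vertex_pos c) (vertex_pos a) = dist (vertex_pos c) (vertex_pos b)"
      by (elim disjE) (auto dest: s)
  qed (use ai in \<open>simp_all add: coords_triple\<close>)
  then show ?thesis unfolding acute_isosceles_face_def abc(2) by blast
qed

lemma hats:
  "hat vertex_pos face_sets 4 5 6 7 1 2 3" "hat vertex_pos face_sets 8 9 10 11 0 3 2"
  "hat vertex_pos face_sets 12 13 14 15 3 0 1" "hat vertex_pos face_sets 16 17 18 19 2 1 0"
proof -
  have faces: "set (hat_faces 4 5 6 7 1 2 3) \<subseteq> set faces" "set (hat_faces 8 9 10 11 0 3 2) \<subseteq> set faces"
    "set (hat_faces 12 13 14 15 3 0 1) \<subseteq> set faces" "set (hat_faces 16 17 18 19 2 1 0) \<subseteq> set faces"
    by (auto simp: faces_def)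
  have face_sets: "set ` set (hat_faces t x y z a b c) \<subseteq> face_sets" if "set (hat_faces t x y z a b c) \<subseteq> set faces"
    for t x y z a b c using that by (auto simp: face_sets_def)
  show "hat vertex_pos face_sets 4 5 6 7 1 2 3" "hat vertex_pos face_sets 8 9 10 11 0 3 2"
    "hat vertex_pos face_sets 12 13 14 15 3 0 1" "hat vertex_pos face_sets 16 17 18 19 2 1 0"
    using face_sets[OF faces(1)] face_sets[OF faces(2)] face_sets[OF faces(3)] face_sets[OF faces(4)]
    unfolding hat_def vertex_pos_def dist_emb sqdist3_def vertices_def hat_faces_def by simp_all
qed

text \<open>\<open>hat_covers\<close> is stated for the vectors a(i), and the corners are 2 a(i);
  hence the factors 1/2 on the corners and the halved coefficients 5/4 and 4.\<close>

lemma hat_cone_covers: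
  assumes "0 \<le> \<alpha>" "0 \<le> \<beta>" "0 \<le> \<gamma>"
    and p: "p = \<alpha> *\<^sub>R (1/2) *\<^sub>R vertex_pos a + \<beta> *\<^sub>R (1/2) *\<^sub>R vertex_pos b + \<gamma> *\<^sub>R (1/2) *\<^sub>R vertex_pos c" "p \<noteq> 0"
    and x: "vertex_pos x = vertex_pos a + (5/4) *\<^sub>R vertex_pos b + (5/4) *\<^sub>R vertex_pos c"
    and y: "vertex_pos y = (5/4) *\<^sub>R vertex_pos a + vertex_pos b + (5/4) *\<^sub>R vertex_pos c"
    and z: "vertex_pos z = (5/4) *\<^sub>R vertex_pos a + (5/4) *\<^sub>R vertex_pos b + vertex_pos c"
    and t: "vertex_pos t = 4 *\<^sub>R vertex_pos a + 4 *\<^sub>R vertex_pos b + 4 *\<^sub>R vertex_pos c"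
    and hat: "hat vertex_pos face_sets t x y z a b c"
  shows "\<exists>f\<in>face_sets. \<exists>d>0. d *\<^sub>R p \<in> tri vertex_pos f"
proof -
  have "cone3 (vertex_pos t) (vertex_pos x) (vertex_pos y) p \<or> cone3 (vertex_pos t) (vertex_pos y) (vertex_pos z) p \<or> cone3 (vertex_pos t) (vertex_pos z) (vertex_pos x) p \<or>
    cone3 (vertex_pos a) (vertex_pos y) (vertex_pos z) p \<or> cone3 (vertex_pos b) (vertex_pos z) (vertex_pos x) p \<or> cone3 (vertex_pos c) (vertex_pos x) (vertex_pos y) p \<or>
    cone3 (vertex_pos x) (vertex_pos b) (vertex_pos c) p \<or> cone3 (vertex_pos y) (vertex_pos c) (vertex_pos a) p \<or> cone3 (vertex_pos z) (vertex_pos a) (vertex_pos b) p"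
    by (rule hat_covers[OF assms(1-4)]) (simp_all add: x y z t)
  then show ?thesis
    using cone3_meets_tri[OF _ p(2), of vertex_pos] hat unfolding hat_def by blast
qed

text \<open>The numbers \<open>k\<close>, \<open>l\<close>, \<open>m\<close>, \<open>n\<close> are
  the inner products of \<open>p\<close> with the a(i), and \<open>p\<close> is a quarter of the sum
  of the a(i) weighted by them. Since the a(i) sum to 0, the smallest weight may be subtracted from
  all; then \<open>p\<close> lies in the cone of the other three corners.\<close>

lemma face_sets_cover:
  fixes p :: "real^3"
  assumes "p \<noteq> 0"
  shows "\<exists>f\<in>face_sets. \<exists>d>0. d *\<^sub>R p \<in> tri vertex_pos f"
proof -
  define k where "k = p $ 1 + p $ 2 + p $ 3"
  define l where "l = p $ 1 - p $ 2 - p $ 3"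
  define m where "m = - p $ 1 + p $ 2 - p $ 3"
  define n where "n = - p $ 1 - p $ 2 + p $ 3"
  note defs = k_def l_def m_def n_def
  note vec = vec_eq_iff forall_3 vertex_pos_def vertices_def
  consider "k \<le> l \<and> k \<le> m \<and> k \<le> n" | "l \<le> k \<and> l \<le> m \<and> l \<le> n"
    | "m \<le> k \<and> m \<le> l \<and> m \<le> n" | "n \<le> k \<and> n \<le> l \<and> n \<le> m" by linarith
  then show ?thesis
  proof cases
    case 1
    show ?thesis
      by (rule hat_cone_covers[OF _ _ _ _ assms _ _ _ _ hats(1), of "(l - k) / 4" "(m - k) / 4" "(n - k) / 4"])
        (use 1 in \<open>simp_all add: vec, simp_all add: defs field_simps\<close>)
  next
    case 2
    show ?thesis
      by (rule hat_cone_covers[OF _ _ _ _ assms _ _ _ _ hats(2), of "(k - l) / 4" "(n - l) / 4" "(m - l) / 4"])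
        (use 2 in \<open>simp_all add: vec, simp_all add: defs field_simps\<close>)
  next
    case 3
    show ?thesis
      by (rule hat_cone_covers[OF _ _ _ _ assms _ _ _ _ hats(3), of "(n - m) / 4" "(k - m) / 4" "(l - m) / 4"])
        (use 3 in \<open>simp_all add: vec, simp_all add: defs field_simps\<close>)
  next
    case 4
    show ?thesis
      by (rule hat_cone_covers[OF _ _ _ _ assms _ _ _ _ hats(4), of "(m - n) / 4" "(l - n) / 4" "(k - n) / 4"])
        (use 4 in \<open>simp_all add: vec, simp_all add: defs field_simps\<close>)
  qed
qed

interpretation hatted: radial_complex vertex_pos face_sets
proof
  show "finite face_sets" by (rule finite_face_sets)
  show "finite f" if "f \<in> face_sets" for f using card_face[OF that] by (intro card_ge_0_finite) simp
  show "\<exists>m. \<forall>v\<in>f. m \<bullet> vertex_pos v = 1" if "f \<in> face_sets" for f using that by (rule face_plane)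
  show "\<exists>n. separates vertex_pos n f g \<or> separates vertex_pos n g f" if "f \<in> face_sets" "g \<in> face_sets" "f \<noteq> g" for f g
    using that by (rule face_sets_separated)
  show "\<exists>f\<in>face_sets. \<exists>c>0. c *\<^sub>R p \<in> tri vertex_pos f" if "p \<noteq> 0" for p using that by (rule face_sets_cover)
qed

section \<open>3-connectivity of the graph\<close>

lemma edge_of_face: "{u, v, w} \<in> face_sets \<Longrightarrow> u \<noteq> v \<Longrightarrow> {u, v} \<in> edges face_sets"
  unfolding edges_def by auto

definition step :: "nat set \<Rightarrow> nat \<Rightarrow> nat \<Rightarrow> bool" where
  "step S u v \<longleftrightarrow> {u, v} \<in> edges face_sets \<and> u \<in> \<Union>face_sets - S \<and> v \<in> \<Union>face_sets - S"

lemma step_face: "{u, v, w} \<in> face_sets \<Longrightarrow> u \<noteq> v \<Longrightarrow> u \<notin> S \<Longrightarrow> v \<notin> S \<Longrightarrow> step S u v"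
  unfolding step_def using edge_of_face[of u v w] by blast

lemma card_le_2_eq:
  assumes "finite S" "card S \<le> 2" "b \<in> S" "c \<in> S" "b \<noteq> c"
  shows "S = {b, c}"
  using card_seteq[of S "{b, c}"] assms by auto

text \<open>The plan is that each surviving vertex reaches a surviving corner, while corners are
  pairwise adjacent. Here \<open>x\<close> is joined to \<open>b\<close> and \<open>c\<close>; if
  both are deleted they exhaust \<open>S\<close>, and the way over \<open>y\<close> to
  \<open>a\<close> is free.\<close>

lemma inner_reaches_corner:
  assumes hat: "hat vertex_pos face_sets t x y z a b c" and S: "finite S" "card S \<le> 2" and x: "x \<notin> S"
  shows "\<exists>k\<in>{a, b, c} - S. (step S)\<^sup>*\<^sup>* x k"
proof -
  note h = hat[unfolded hat_def]
  note d = hat_distinct[OF hat]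
  have xbc: "{x, b, c} \<in> face_sets" "{x, c, b} \<in> face_sets" "{x, y, c} \<in> face_sets" "{y, a, c} \<in> face_sets"
    using h by (simp_all add: insert_commute)
  show ?thesis
  proof (cases "b \<in> S \<and> c \<in> S")
    case True
    then have "S = {b, c}" using card_le_2_eq[OF S, of b c] d by simp
    then have "step S x y" "step S y a" "a \<notin> S"
      using step_face[OF xbc(3)] step_face[OF xbc(4)] d by auto
    then show ?thesis by (intro bexI[of _ a]) (auto intro: converse_rtranclp_into_rtranclp)
  next
    case False
    then show ?thesis
      using step_face[OF xbc(1), of S] step_face[OF xbc(2), of S] x d by auto
  qed
qed

text \<open>Two deletions cannot remove all three neighbours of the tip.\<close>

lemma tip_reaches_corner:
  assumes hat: "hat vertex_pos face_sets t x y z a b c" and S: "finite S" "card S \<le> 2" and t: "t \<notin> S"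
  shows "\<exists>k\<in>{a, b, c} - S. (step S)\<^sup>*\<^sup>* t k"
proof -
  note h = hat[unfolded hat_def]
  note d = hat_distinct[OF hat]
  have reach: "\<exists>k\<in>{a, b, c} - S. (step S)\<^sup>*\<^sup>* t k"
    if "step S t v" "\<exists>k\<in>{a, b, c} - S. (step S)\<^sup>*\<^sup>* v k" for v
    using that by (meson converse_rtranclp_into_rtranclp)
  have "\<not> {x, y, z} \<subseteq> S"
  proof
    assume "{x, y, z} \<subseteq> S"
    then have "card {x, y, z} \<le> card S" using S(1) card_mono by blast
    then show False using S(2) d by simp
  qed
  then consider "x \<notin> S" | "y \<notin> S" | "z \<notin> S" by blast
  then show ?thesis
  proof cases
    case 1
    have "step S t x" by (rule step_face[of _ _ y]) (use h d t 1 in auto)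
    then show ?thesis using reach inner_reaches_corner[OF hat S 1] by blast
  next
    case 2
    have "step S t y" by (rule step_face[of _ _ z]) (use h d t 2 in auto)
    then show ?thesis using reach inner_reaches_corner[OF hat_rotate[OF hat] S 2] by blast
  next
    case 3
    have "step S t z" by (rule step_face[of _ _ x]) (use h d t 3 in auto)
    then show ?thesis using reach inner_reaches_corner[OF hat_rotate[OF hat_rotate[OF hat]] S 3] by blast
  qed
qed

lemma hat_reaches_corner:
  assumes hat: "hat vertex_pos face_sets t x y z a b c" and S: "finite S" "card S \<le> 2"
    and v: "v \<in> {t, x, y, z}" "v \<notin> S" and abc: "{a, b, c} \<subseteq> {..<4}"
  shows "\<exists>k\<in>{..<4} - S. (step S)\<^sup>*\<^sup>* v k"
proof -
  note h2 = hat_rotate[OF hat] and h3 = hat_rotate[OF hat_rotate[OF hat]]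
  have "\<exists>k\<in>{a, b, c} - S. (step S)\<^sup>*\<^sup>* v k"
    using v tip_reaches_corner[OF hat S] inner_reaches_corner[OF hat S] inner_reaches_corner[OF h2 S]
      inner_reaches_corner[OF h3 S] by (auto simp: insert_commute)
  then show ?thesis using abc by blast
qed

lemma corners_adjacent:
  assumes "u < 4" "v < 4" "u \<noteq> v" "u \<notin> S" "v \<notin> S"
  shows "step S u v"
proof -
  have "{1, 2, 7} \<in> face_sets" "{2, 3, 5} \<in> face_sets" "{3, 1, 6} \<in> face_sets" "{0, 3, 11} \<in> face_sets" "{2, 0, 10} \<in> face_sets" "{0, 1, 13} \<in> face_sets"
    using hats unfolding hat_def by (simp_all add: insert_commute)
  then have "step S 1 2 \<or> 1 \<in> S \<or> 2 \<in> S" "step S 2 3 \<or> 2 \<in> S \<or> 3 \<in> S" "step S 3 1 \<or> 3 \<in> S \<or> 1 \<in> S"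
    "step S 0 3 \<or> 0 \<in> S \<or> 3 \<in> S" "step S 2 0 \<or> 2 \<in> S \<or> 0 \<in> S" "step S 0 1 \<or> 0 \<in> S \<or> 1 \<in> S"
    using step_face by (metis zero_neq_one one_eq_numeral_iff numeral_eq_iff num.distinct zero_neq_numeral num.inject)+
  moreover have "step S v u = step S u v" for u v by (auto simp: step_def insert_commute)
  moreover have "u = 0 \<or> u = 1 \<or> u = 2 \<or> u = 3" "v = 0 \<or> v = 1 \<or> v = 2 \<or> v = 3" using assms by auto
  ultimately show ?thesis using assms(3-5) by metis
qed

lemma reaches_corner:
  assumes S: "finite S" "card S \<le> 2" and v: "v \<in> \<Union>face_sets - S"
  shows "\<exists>k\<in>{..<4} - S. (step S)\<^sup>*\<^sup>* v k"
proof -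
  have "v < 20" "v \<notin> S" using v by (auto simp: Union_face_sets)
  then have "v < 4 \<or> v \<in> {4, 5, 6, 7} \<or> v \<in> {8, 9, 10, 11} \<or> v \<in> {12, 13, 14, 15} \<or>
      v \<in> {16, 17, 18, 19}" by simp arith
  then consider "v < 4" | "v \<in> {4, 5, 6, 7}" | "v \<in> {8, 9, 10, 11}" | "v \<in> {12, 13, 14, 15}"
    | "v \<in> {16, 17, 18, 19}" by blast
  then show ?thesis
  proof cases
    case 1
    then show ?thesis using \<open>v \<notin> S\<close> by (intro bexI[of _ v]) auto
  next
    case 2
    then show ?thesis using hat_reaches_corner[OF hats(1) S _ \<open>v \<notin> S\<close>] by simp
  next
    case 3
    then show ?thesis using hat_reaches_corner[OF hats(2) S _ \<open>v \<notin> S\<close>] by simp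
  next
    case 4
    then show ?thesis using hat_reaches_corner[OF hats(3) S _ \<open>v \<notin> S\<close>] by simp
  next
    case 5
    then show ?thesis using hat_reaches_corner[OF hats(4) S _ \<open>v \<notin> S\<close>] by simp
  qed
qed

lemma three_connected_face_sets: "three_connected (\<Union>face_sets) (edges face_sets)"
  unfolding three_connected_def
proof (intro conjI allI impI)
  show "finite (\<Union>face_sets)" "4 \<le> card (\<Union>face_sets)" by (simp_all add: Union_face_sets)
  fix S assume S: "S \<subseteq> \<Union>face_sets \<and> card S \<le> 2"
  then have fin: "finite S" by (auto simp: Union_face_sets intro: finite_subset)
  have sym: "symp (step S)" by (auto simp: symp_def step_def insert_commute)
  have "(step S)\<^sup>*\<^sup>* u v" if uv: "u \<in> \<Union>face_sets - S" "v \<in> \<Union>face_sets - S" for u v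
  proof -
    obtain k l where k: "k \<in> {..<4} - S" "(step S)\<^sup>*\<^sup>* u k" and l: "l \<in> {..<4} - S" "(step S)\<^sup>*\<^sup>* v l"
      using reaches_corner[OF fin] S uv by meson
    have "(step S)\<^sup>*\<^sup>* k l"
      using corners_adjacent[of k l S] k(1) l(1) by (cases "k = l") auto
    moreover have "(step S)\<^sup>*\<^sup>* l v" using sympD[OF symp_rtranclp[OF sym] l(2)] .
    ultimately show ?thesis using k(2) by (meson rtranclp_trans)
  qed
  moreover have "(\<lambda>x y. {x, y} \<in> edges face_sets \<and> x \<in> \<Union>face_sets - S \<and> y \<in> \<Union>face_sets - S) = step S"
    by (simp add: step_def fun_eq_iff)
  ultimately show "graph_connected (\<Union>face_sets - S) (edges face_sets)"
    unfolding graph_connected_def by simp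
qed

lemma polyhedron: "topologically_convex_triangle_polyhedron vertex_pos face_sets"
  unfolding topologically_convex_triangle_polyhedron_def
proof (intro conjI ballI impI)
  show "finite face_sets" by (rule finite_face_sets)
  show "face_sets \<noteq> {}" using card_face_sets by auto
  show "card f = 3" if "f \<in> face_sets" for f using that by (rule card_face)
  show "\<not> collinear (vertex_pos ` f)" if "f \<in> face_sets" for f
    using that by (rule faceE) (use face_noncollinear in auto)
  show "inj_on vertex_pos (\<Union>face_sets)" by (rule inj_pos)
  show "tri vertex_pos f \<inter> tri vertex_pos g = tri vertex_pos (f \<inter> g)" if "f \<in> face_sets" "g \<in> face_sets" for f g
    using that by (rule hatted.tri_Int)
  show "card {f \<in> face_sets. e \<subseteq> f} = 2" if "e \<in> edges face_sets" for e using that by (rule edge_two_faces)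
  show "\<not> coplanar (vertex_pos ` (f \<union> g))" if "f \<in> face_sets" "g \<in> face_sets" "f \<noteq> g \<and> card (f \<inter> g) = 2" for f g
    using adjacent_not_coplanar that by blast
  show "surface vertex_pos face_sets homeomorphic sphere (0::real^3) 1" by (rule hatted.surface_homeomorphic_sphere)
  show "\<exists>P::(real^3) set. compact P \<and> frontier P = surface vertex_pos face_sets"
    using hatted.compact_surface hatted.frontier_surface by blast
  show "three_connected (\<Union>face_sets) (edges face_sets)" by (rule three_connected_face_sets)
qed

section \<open>Edge count and the final contradiction\<close>

definition corner_edges :: "nat set list" where
  "corner_edges = [{0, 1}, {0, 2}, {0, 3}, {1, 2}, {1, 3}, {2, 3}]"

definition all_edges :: "nat set list" where
  "all_edges = corner_edges @ hat_edges 4 5 6 7 1 2 3 @ hat_edges 8 9 10 11 0 3 2 @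
    hat_edges 12 13 14 15 3 0 1 @ hat_edges 16 17 18 19 2 1 0"

lemma hat_face_edges:
  assumes "f \<in> set (hat_faces t x y z a b c)" "e \<subseteq> set f" "card e = 2"
  shows "e \<in> set (hat_edges t x y z a b c) \<union> {{a, b}, {b, c}, {c, a}}"
proof -
  obtain u v w where f: "f = [u, v, w]" using assms(1) by (auto simp: hat_faces_def)
  let ?E = "set (hat_edges t x y z a b c) \<union> {{a, b}, {b, c}, {c, a}}"
  have "{u, v} \<in> ?E \<and> {v, w} \<in> ?E \<and> {w, u} \<in> ?E"
    using assms(1) unfolding f hat_faces_def list.set insert_iff empty_iff list.inject hat_edges_def
    by (elim disjE conjE FalseE) (simp_all add: insert_commute)
  moreover have "e = {u, v} \<or> e = {v, w} \<or> e = {w, u}"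
    using two_subset_of_triple[of e u v w] assms(2,3) f by simp
  ultimately show ?thesis by metis
qed

lemma edges_subset: "edges face_sets \<subseteq> set all_edges"
proof
  fix e assume "e \<in> edges face_sets"
  then obtain f where f: "f \<in> set faces" "e \<subseteq> set f" "card e = 2" by (auto simp: edges_def face_sets_def)
  have corner: "{u, v} \<in> set corner_edges" if "u < 4" "v < 4" "u \<noteq> v" for u v
  proof -
    have "u = 0 \<or> u = 1 \<or> u = 2 \<or> u = 3" "v = 0 \<or> v = 1 \<or> v = 2 \<or> v = 3" using that by auto
    then show ?thesis using that(3) by (elim disjE) (simp_all add: corner_edges_def insert_commute)
  qed
  have "e \<in> set all_edges" if "f \<in> set (hat_faces t x y z a b c)" "a < 4" "b < 4" "c < 4"
    "a \<noteq> b" "b \<noteq> c" "c \<noteq> a" "set (hat_edges t x y z a b c) \<subseteq> set all_edges" for t x y z a b c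
    using hat_face_edges[OF that(1) f(2,3)] corner[of a b] corner[of b c] corner[of c a] that(2-)
    by (auto simp: all_edges_def)
  note * = this
  have "f \<in> set (hat_faces 4 5 6 7 1 2 3) \<or> f \<in> set (hat_faces 8 9 10 11 0 3 2) \<or>
      f \<in> set (hat_faces 12 13 14 15 3 0 1) \<or> f \<in> set (hat_faces 16 17 18 19 2 1 0)"
    using f(1) unfolding faces_def set_append by blast
  then show "e \<in> set all_edges"
    by (elim disjE) (erule *; simp add: all_edges_def Un_assoc; blast?)+
qed

text \<open>54 = 6 + 4 * 12, as the length of a list containing all edges; the final count asks only
  for this upper bound.\<close>

lemma card_edges: "finite (edges face_sets)" "card (edges face_sets) \<le> 54"
proof -
  show "finite (edges face_sets)" using edges_subset finite_subset by blast
  have "card (edges face_sets) \<le> card (set all_edges)" using edges_subset card_mono by blast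
  also have "\<dots> \<le> length all_edges" by (rule card_length)
  finally show "card (edges face_sets) \<le> 54" by (simp add: all_edges_def corner_edges_def hat_edges_def)
qed

text \<open>Each interior edge of a hat has an end among the four vertices private to that
  hat.\<close>

lemma hat_edges_disjoint:
  assumes "{t, x, y, z} \<inter> {t', x', y', z', a', b', c'} = {}"
  shows "set (hat_edges t x y z a b c) \<inter> set (hat_edges t' x' y' z' a' b' c') = {}"
proof -
  have "e \<inter> {t, x, y, z} \<noteq> {}" if "e \<in> set (hat_edges t x y z a b c)" for e
    using that by (auto simp: hat_edges_def)
  moreover have "e \<subseteq> {t', x', y', z', a', b', c'}" if "e \<in> set (hat_edges t' x' y' z' a' b' c')" for e
    using that by (auto simp: hat_edges_def)
  ultimately show ?thesis using assms by blast
qed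

lemma not_unfoldable: "\<not> one_piece_edge_unfolding vertex_pos face_sets C"
proof
  assume unf: "one_piece_edge_unfolding vertex_pos face_sets C"
  then have CF: "C \<subseteq> edges face_sets" and conn: "\<And>f g. f \<in> face_sets \<Longrightarrow> g \<in> face_sets \<Longrightarrow> (uncut_adj face_sets C)\<^sup>*\<^sup>* f g"
    by (auto simp: one_piece_edge_unfolding_def)
  from unf obtain A :: "nat set \<Rightarrow> real^3 \<Rightarrow> real^2" where
    A: "\<forall>f\<in>face_sets. \<forall>x\<in>tri vertex_pos f. \<forall>y\<in>tri vertex_pos f. dist (A f x) (A f y) = dist x y"
      "\<forall>f\<in>face_sets. \<forall>g\<in>face_sets. uncut_adj face_sets C f g \<longrightarrow> (\<forall>x\<in>tri vertex_pos (f \<inter> g). A f x = A g x)"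
      "\<forall>f\<in>face_sets. \<forall>g\<in>face_sets. \<forall>x\<in>tri vertex_pos f. \<forall>y\<in>tri vertex_pos g.
          A f x = A g y \<longrightarrow> x = y \<and> (glued_at vertex_pos face_sets C x)\<^sup>*\<^sup>* f g"
    unfolding one_piece_edge_unfolding_def by blast
  interpret one_piece_net vertex_pos face_sets C A
  proof
    show "card f = 3 \<and> \<not> collinear (vertex_pos ` f)" if "f \<in> face_sets" for f
      using polyhedron that by (simp add: topologically_convex_triangle_polyhedron_def)
    show "A f x = A g x" if "uncut_adj face_sets C f g" "x \<in> tri vertex_pos (f \<inter> g)" for f g x
      using A(2) that by (simp add: uncut_adj_def)
  qed (use hatted.tri_Int A(1,3) conn edge_two_faces in blast)+
  let ?H1 = "set (hat_edges 4 5 6 7 1 2 3)" and ?H2 = "set (hat_edges 8 9 10 11 0 3 2)"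
    and ?H3 = "set (hat_edges 12 13 14 15 3 0 1)" and ?H4 = "set (hat_edges 16 17 18 19 2 1 0)"
  have finC: "finite C" using CF card_edges(1) finite_subset by blast
  have "card ((C \<inter> ?H1) \<union> (C \<inter> ?H2) \<union> (C \<inter> ?H3) \<union> (C \<inter> ?H4)) =
      card (C \<inter> ?H1) + card (C \<inter> ?H2) + card (C \<inter> ?H3) + card (C \<inter> ?H4)"
  proof -
    have "?H1 \<inter> ?H2 = {}" "?H1 \<inter> ?H3 = {}" "?H1 \<inter> ?H4 = {}" "?H2 \<inter> ?H3 = {}" "?H2 \<inter> ?H4 = {}"
      "?H3 \<inter> ?H4 = {}"
      by (rule hat_edges_disjoint, simp)+
    then have "(C \<inter> ?H1) \<inter> (C \<inter> ?H2) = {}" "(C \<inter> ?H1 \<union> C \<inter> ?H2) \<inter> (C \<inter> ?H3) = {}"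
      "(C \<inter> ?H1 \<union> C \<inter> ?H2 \<union> C \<inter> ?H3) \<inter> (C \<inter> ?H4) = {}" by blast+
    moreover have "finite (C \<inter> X)" for X using finC by simp
    ultimately show ?thesis by (simp only: card_Un_disjoint finite_UnI)
  qed
  moreover have "card ((C \<inter> ?H1) \<union> (C \<inter> ?H2) \<union> (C \<inter> ?H3) \<union> (C \<inter> ?H4)) \<le> card C"
    by (intro card_mono finC) blast
  ultimately have "20 \<le> card C"
    using hat_five_cuts[OF hats(1)] hat_five_cuts[OF hats(2)] hat_five_cuts[OF hats(3)]
      hat_five_cuts[OF hats(4)] by linarith
  obtain f0 where f0: "f0 \<in> face_sets" using card_face_sets by fastforce
  have "card face_sets \<le> card (edges face_sets - C) + 1"
    by (rule connected_many_edges[OF finite_face_sets f0 conn[OF f0] edge_two_faces card_edges(1)])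
  moreover have "card (edges face_sets - C) = card (edges face_sets) - card C"
    using CF finC by (intro card_Diff_subset)
  \<comment> \<open>At most 54 - 20 = 34 edges are uncut, but joining 36 faces takes 35.\<close>
  ultimately show False using \<open>20 \<le> card C\<close> card_face_sets card_edges(2) by linarith
qed

theorem theorem1:
  shows "\<exists>(pos :: nat \<Rightarrow> real^3) (F :: nat set set).
           topologically_convex_triangle_polyhedron pos F \<and>
           (\<forall>f\<in>F. acute_isosceles_face pos f) \<and>
           \<not> (\<exists>C. one_piece_edge_unfolding pos F C)"
  using polyhedron faces_acute not_unfoldable by blast

end
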